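(* Let $X\subseteq\mathbb{R}^d$ be a compact set with $\mathcal{H}^{d-1}(\partial X)<\infty$, let $\rho$ be a PSF, $\beta\in(0,1)$ and $r\ge0$ an integer. Then the estimator $$\hat\Phi_d^{r,0}(X)=a^d\frac1{r!}\sum_{z\in a\mathbb{L}_c}\mathbf{1}_{\{\theta_a^X(z)\ge\beta\}}\,z^r$$ is asymptotically unbiased for the volume tensor $\Phi_d^{r,0}(X)=\frac1{r!}\int_Xx^r\,\mathcal{H}^d(dx)$, i.e. $\lim_{a\to0^+}E\hat\Phi_d^{r,0}(X)=\Phi_d^{r,0}(X)$.
   Context: A point spread function (PSF) is a measurable function $\rho:\mathbb{R}^d\to[0,\infty)$ with $\int_{\mathbb{R}^d}\rho(z)\,dz=1$. For $a>0$ let $\theta_a^X(x)=a^{-d}\int_X\rho(a^{-1}(z-x))\,dz$. $\mathbb{L}$ is the lattice spanned by a basis $v_1,\dots,v_d$ of $\mathbb{R}^d$ whose fundamental cell $C_v=\{\sum_i\lambda_iv_i\mid0\le\lambda_i<1\}$ has volume 1; $\mathbb{L}_c=\mathbb{L}+c$ with $c$ uniformly random in $C_v$, and $E$ is expectation over $c$. $x^r$ denotes the $r$-fold symmetric tensor power of $x\in\mathbb{R}^d$, identified with the $r$-linear functional $(w_1,\dots,w_r)\mapsto\prod_{k=1}^r\langle x,w_k\rangle$ (and $x^0=1$). $\mathcal{H}^k$ is $k$-dimensional Hausdorff measure. *)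

theory Defs
  imports "HOL-Analysis.Analysis"
begin

subsection \<open>Hausdorff measure\<close>

text \<open>
  The constant \<open>unit_ball_vol k / 2 ^ k\<close> is the usual normalisation, for which
  \<open>k\<close>-dimensional Hausdorff measure agrees with \<open>k\<close>-dimensional volume.  The empty set has
  gauge 0 also for \<open>k = 0\<close>, where a nonempty set of diameter 0 has gauge 1.
\<close>

definition hausdorff_gauge :: "nat \<Rightarrow> 'a::metric_space set \<Rightarrow> ennreal" where
  "hausdorff_gauge k U =
     (if U = {} then 0 else ennreal (unit_ball_vol (real k) * (diameter U / 2) ^ k))"

text \<open>Boundedness is required explicitly because \<^const>\<open>diameter\<close> is meaningless otherwise.\<close>

definition hausdorff_covers :: "real \<Rightarrow> 'a::metric_space set \<Rightarrow> (nat \<Rightarrow> 'a set) set" where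
  "hausdorff_covers \<delta> A =
     {U. A \<subseteq> (\<Union>i. U i) \<and> (\<forall>i. bounded (U i) \<and> diameter (U i) \<le> \<delta>)}"

definition hausdorff_pre :: "nat \<Rightarrow> real \<Rightarrow> 'a::metric_space set \<Rightarrow> ennreal" where
  "hausdorff_pre k \<delta> A = (INF U\<in>hausdorff_covers \<delta> A. \<Sum>i. hausdorff_gauge k (U i))"

definition hausdorff_outer :: "nat \<Rightarrow> 'a::metric_space set \<Rightarrow> ennreal" where
  "hausdorff_outer k A = (SUP \<delta>\<in>{0<..}. hausdorff_pre k \<delta> A)"

definition hausdorff_measure :: "nat \<Rightarrow> 'a::metric_space measure" where
  "hausdorff_measure k = measure_of UNIV (sets borel) (hausdorff_outer k)"

text \<open>
  The function \<^const>\<open>measure_of\<close> returns the zero measure when its argument is not countably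
  additive; the following lemmas show that this does not happen here.
\<close>

lemma hausdorff_pre_mono:
  assumes "A \<subseteq> B" "\<delta>' \<le> \<delta>"
  shows "hausdorff_pre k \<delta> A \<le> hausdorff_pre k \<delta>' B"
proof -
  have "hausdorff_covers \<delta>' B \<subseteq> hausdorff_covers \<delta> A"
    using assms unfolding hausdorff_covers_def by (blast intro: order_trans)
  then show ?thesis
    unfolding hausdorff_pre_def by (rule INF_superset_mono) simp
qed

lemma hausdorff_outer_mono: "A \<subseteq> B \<Longrightarrow> hausdorff_outer k A \<le> hausdorff_outer k B"
  unfolding hausdorff_outer_def by (intro SUP_mono' hausdorff_pre_mono order_refl)

lemma hausdorff_pre_le_outer: "\<delta> > 0 \<Longrightarrow> hausdorff_pre k \<delta> A \<le> hausdorff_outer k A"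
  unfolding hausdorff_outer_def by (rule SUP_upper) auto

lemma hausdorff_outer_empty: "hausdorff_outer k {} = 0"
proof -
  have "hausdorff_pre k \<delta> {} \<le> 0" if "\<delta> > 0" for \<delta>
    unfolding hausdorff_pre_def
    by (rule INF_lower2[of "\<lambda>_. {}"])
       (use that in \<open>auto simp: hausdorff_covers_def hausdorff_gauge_def\<close>)
  then have "hausdorff_outer k {} \<le> 0"
    unfolding hausdorff_outer_def by (intro SUP_least) auto
  then show ?thesis by simp
qed

lemma hausdorff_pre_countably_subadditive:
  "hausdorff_pre k \<delta> (\<Union>n::nat. A n) \<le> (\<Sum>n. hausdorff_pre k \<delta> (A n))"
proof (rule ennreal_le_epsilon)
  fix e :: real assume fin: "(\<Sum>n. hausdorff_pre k \<delta> (A n)) < top" and e: "0 < e"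
  have "\<exists>U\<in>hausdorff_covers \<delta> (A n).
          (\<Sum>i. hausdorff_gauge k (U i)) < hausdorff_pre k \<delta> (A n) + e * (1/2) ^ Suc n" for n
  proof -
    have "hausdorff_pre k \<delta> (A n) \<noteq> top"
      using ennreal_suminf_lessD[OF fin, of n] by auto
    then have "hausdorff_pre k \<delta> (A n) < hausdorff_pre k \<delta> (A n) + ennreal (e * (1/2) ^ Suc n)"
      using e by (cases "hausdorff_pre k \<delta> (A n)")
        (auto simp: ennreal_plus[symmetric] ennreal_less_iff simp del: ennreal_plus)
    then show ?thesis
      unfolding hausdorff_pre_def INF_less_iff by simp
  qed
  then obtain U where U: "\<And>n. U n \<in> hausdorff_covers \<delta> (A n)"
    and U_le: "\<And>n. (\<Sum>i. hausdorff_gauge k (U n i)) < hausdorff_pre k \<delta> (A n) + e * (1/2) ^ Suc n"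
    by metis
  define V where "V = (\<lambda>i. case prod_decode i of (m, n) \<Rightarrow> U m n)"
  have "V \<in> hausdorff_covers \<delta> (\<Union>n. A n)"
  proof -
    have "\<exists>i. x \<in> V i" if x: "x \<in> A n" for x n
    proof -
      obtain j where "x \<in> U n j"
        using U[of n] x by (auto simp: hausdorff_covers_def)
      then have "x \<in> V (prod_encode (n, j))"
        by (simp add: V_def)
      then show ?thesis by blast
    qed
    then show ?thesis
      using U by (auto simp: hausdorff_covers_def V_def split: prod.split)
  qed
  then have "hausdorff_pre k \<delta> (\<Union>n. A n) \<le> (\<Sum>i. hausdorff_gauge k (V i))"
    unfolding hausdorff_pre_def by (rule INF_lower)
  also have "\<dots> = (\<Sum>i. (\<lambda>(m, n). hausdorff_gauge k (U m n)) (prod_decode i))"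
    by (simp add: V_def case_prod_beta)
  also have "\<dots> = (\<Sum>m. \<Sum>n. hausdorff_gauge k (U m n))"
    by (rule suminf_ennreal_2dimen) simp
  also have "\<dots> \<le> (\<Sum>m. hausdorff_pre k \<delta> (A m) + ennreal (e * (1/2) ^ Suc m))"
    by (intro suminf_le order.strict_implies_order U_le) auto
  also have "\<dots> = (\<Sum>m. hausdorff_pre k \<delta> (A m)) + (\<Sum>m. ennreal (e * (1/2) ^ Suc m))"
    by (rule suminf_add[symmetric]) auto
  also have "(\<Sum>m. ennreal (e * (1/2) ^ Suc m)) = ennreal e"
    using sums_mult[OF power_half_series, of e] e by (intro suminf_ennreal_eq) auto
  finally show "hausdorff_pre k \<delta> (\<Union>n. A n) \<le> (\<Sum>n. hausdorff_pre k \<delta> (A n)) + ennreal e" .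
qed

lemma hausdorff_outer_countably_subadditive:
  "hausdorff_outer k (\<Union>n::nat. A n) \<le> (\<Sum>n. hausdorff_outer k (A n))"
  unfolding hausdorff_outer_def[of k "\<Union>n. A n"]
proof (rule SUP_least)
  fix \<delta> :: real assume "\<delta> \<in> {0<..}"
  then have "(\<Sum>n. hausdorff_pre k \<delta> (A n)) \<le> (\<Sum>n. hausdorff_outer k (A n))"
    by (intro suminf_le hausdorff_pre_le_outer) auto
  then show "hausdorff_pre k \<delta> (\<Union>n. A n) \<le> (\<Sum>n. hausdorff_outer k (A n))"
    using hausdorff_pre_countably_subadditive order_trans by blast
qed

lemma outer_measure_space_hausdorff_outer: "outer_measure_space (Pow UNIV) (hausdorff_outer k)"
  unfolding outer_measure_space_def positive_def increasing_def countably_subadditive_def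
  by (auto simp: hausdorff_outer_empty hausdorff_outer_mono hausdorff_outer_countably_subadditive)

lemma hausdorff_outer_Un_le:
  "hausdorff_outer k (A \<union> B) \<le> hausdorff_outer k A + hausdorff_outer k B"
proof -
  let ?C = "\<lambda>n::nat. if n = 0 then A else if n = 1 then B else {}"
  have "(\<Union>n. ?C n) = A \<union> B"
    by (force split: if_splits)
  then have "hausdorff_outer k (A \<union> B) \<le> (\<Sum>n. hausdorff_outer k (?C n))"
    using hausdorff_outer_countably_subadditive[of k ?C] by simp
  also have "\<dots> = (\<Sum>n\<in>{0,1}. hausdorff_outer k (?C n))"
    by (rule suminf_finite) (auto simp: hausdorff_outer_empty)
  finally show ?thesis by simp
qed

lemma hausdorff_outer_metric:
  fixes A B :: "'a::metric_space set"
  assumes d: "d > 0" and sep: "\<And>x y. x \<in> A \<Longrightarrow> y \<in> B \<Longrightarrow> d \<le> dist x y"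
  shows "hausdorff_outer k A + hausdorff_outer k B \<le> hausdorff_outer k (A \<union> B)"
proof -
  have pre: "hausdorff_pre k \<delta> A + hausdorff_pre k \<delta> B \<le> hausdorff_pre k \<delta> (A \<union> B)"
    if \<delta>: "0 < \<delta>" "\<delta> < d" for \<delta>
    unfolding hausdorff_pre_def[of k \<delta> "A \<union> B"]
  proof (rule INF_greatest)
    fix U assume U: "U \<in> hausdorff_covers \<delta> (A \<union> B)"
    define V where "V = (\<lambda>C i. if U i \<inter> C \<noteq> {} then U i else {})"
    have V: "V C \<in> hausdorff_covers \<delta> C" if C: "C \<subseteq> A \<union> B" for C
    proof -
      have "\<exists>i. x \<in> V C i" if x: "x \<in> C" for x
      proof -
        obtain i where "x \<in> U i"
          using U C x unfolding hausdorff_covers_def by blast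
        then have "x \<in> V C i" using x by (auto simp: V_def)
        then show ?thesis ..
      qed
      then have "C \<subseteq> (\<Union>i. V C i)" by blast
      moreover have "bounded (V C i) \<and> diameter (V C i) \<le> \<delta>" for i
        using U \<delta> by (simp add: hausdorff_covers_def V_def)
      ultimately show ?thesis by (simp add: hausdorff_covers_def)
    qed
    have "hausdorff_gauge k (V A i) + hausdorff_gauge k (V B i) \<le> hausdorff_gauge k (U i)" for i
    proof (cases "U i \<inter> A \<noteq> {} \<and> U i \<inter> B \<noteq> {}")
      case True
      then obtain x y where xy: "x \<in> U i" "x \<in> A" "y \<in> U i" "y \<in> B" by auto
      have "dist x y \<le> \<delta>"
      proof -
        have "bounded (U i)" "diameter (U i) \<le> \<delta>"
          using U by (simp_all add: hausdorff_covers_def)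
        then show ?thesis
          using xy(1,3) diameter_bounded_bound order_trans by blast
      qed
      then show ?thesis using sep[of x y] xy \<delta> by linarith
    next
      case False
      then show ?thesis by (auto simp: V_def hausdorff_gauge_def)
    qed
    then have "(\<Sum>i. hausdorff_gauge k (V A i)) + (\<Sum>i. hausdorff_gauge k (V B i))
        \<le> (\<Sum>i. hausdorff_gauge k (U i))"
      by (subst suminf_add) (auto intro!: suminf_le)
    moreover have "hausdorff_pre k \<delta> A \<le> (\<Sum>i. hausdorff_gauge k (V A i))"
      "hausdorff_pre k \<delta> B \<le> (\<Sum>i. hausdorff_gauge k (V B i))"
      unfolding hausdorff_pre_def by (auto intro!: INF_lower V)
    ultimately show "hausdorff_pre k \<delta> A + hausdorff_pre k \<delta> B \<le> (\<Sum>i. hausdorff_gauge k (U i))"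
      by (meson add_mono order_trans)
  qed
  have two: "hausdorff_pre k \<delta> A + hausdorff_pre k \<delta>' B \<le> hausdorff_outer k (A \<union> B)"
    if "\<delta> > 0" "\<delta>' > 0" for \<delta> \<delta>'
  proof -
    define \<epsilon> where "\<epsilon> = min (d / 2) (min \<delta> \<delta>')"
    have \<epsilon>: "0 < \<epsilon>" "\<epsilon> < d" "\<epsilon> \<le> \<delta>" "\<epsilon> \<le> \<delta>'"
      using that d by (auto simp: \<epsilon>_def)
    have "hausdorff_pre k \<delta> A + hausdorff_pre k \<delta>' B \<le> hausdorff_pre k \<epsilon> A + hausdorff_pre k \<epsilon> B"
      by (intro add_mono hausdorff_pre_mono \<epsilon> order_refl)
    also have "\<dots> \<le> hausdorff_outer k (A \<union> B)"
      using pre[OF \<epsilon>(1,2)] hausdorff_pre_le_outer[OF \<epsilon>(1)] order_trans by blast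
    finally show ?thesis .
  qed
  have "(SUP \<delta>\<in>{0<..}. hausdorff_pre k \<delta> A) + (SUP \<delta>\<in>{0<..}. hausdorff_pre k \<delta> B)
      \<le> hausdorff_outer k (A \<union> B)"
    by (subst ennreal_SUP_add_left[symmetric], simp, rule SUP_least,
        subst ennreal_SUP_add_right, simp, rule SUP_least) (use two in auto)
  then show ?thesis by (simp add: hausdorff_outer_def)
qed

lemma hausdorff_outer_rings:
  fixes R :: "nat \<Rightarrow> 'a::metric_space set"
  assumes sep: "\<And>i j. i < j \<Longrightarrow> \<exists>d>0. \<forall>x\<in>R i. \<forall>y. y \<in> R j \<longrightarrow> d \<le> dist x y"
    and RT: "\<And>i. R i \<subseteq> T"
  shows "(\<Sum>i. hausdorff_outer k (R i)) \<le> hausdorff_outer k T"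
proof (rule suminf_le_const)
  fix n :: nat
  have "(\<Sum>i<n. hausdorff_outer k (R i)) \<le> hausdorff_outer k (\<Union>i<n. R i)"
  proof (induction n)
    case 0
    then show ?case by (simp add: hausdorff_outer_empty)
  next
    case (Suc n)
    have "\<exists>d. d > 0 \<and> (\<forall>x\<in>R i. \<forall>y. y \<in> R n \<longrightarrow> d \<le> dist x y)" if "i < n" for i
      using sep[OF that] by auto
    then obtain D where D: "\<And>i. i < n \<Longrightarrow> D i > 0"
      "\<And>i x y. i < n \<Longrightarrow> x \<in> R i \<Longrightarrow> y \<in> R n \<Longrightarrow> D i \<le> dist x y"
      by metis
    define d where "d = Min (insert (1::real) (D ` {..<n}))"
    have "d > 0" using D(1) by (auto simp: d_def)
    have "(\<Sum>i<Suc n. hausdorff_outer k (R i))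
        \<le> hausdorff_outer k (\<Union>i<n. R i) + hausdorff_outer k (R n)"
      using Suc by (simp add: add_right_mono)
    also have "\<dots> \<le> hausdorff_outer k ((\<Union>i<n. R i) \<union> R n)"
    proof (rule hausdorff_outer_metric[OF \<open>d > 0\<close>])
      fix x y assume "x \<in> (\<Union>i<n. R i)" and y: "y \<in> R n"
      then obtain i where i: "i < n" "x \<in> R i" by auto
      have "d \<le> D i" unfolding d_def using i by (intro Min_le) auto
      then show "d \<le> dist x y" using D(2)[OF i y] by linarith
    qed
    also have "(\<Union>i<n. R i) \<union> R n = (\<Union>i<Suc n. R i)"
      by (auto simp: less_Suc_eq)
    finally show ?case .
  qed
  also have "\<dots> \<le> hausdorff_outer k T"
    using RT by (intro hausdorff_outer_mono) auto
  finally show "(\<Sum>i<n. hausdorff_outer k (R i)) \<le> hausdorff_outer k T" .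
qed simp

lemma closed_in_lambda_system_hausdorff_outer:
  fixes F :: "'a::metric_space set"
  assumes F: "closed F"
  shows "F \<in> lambda_system UNIV (Pow UNIV) (hausdorff_outer k)"
proof (cases "F = {}")
  case True
  then show ?thesis by (simp add: lambda_system_def hausdorff_outer_empty)
next
  case nonempty: False
  have le: "hausdorff_outer k (F \<inter> T) + hausdorff_outer k (T - F) \<le> hausdorff_outer k T"
    if fin: "hausdorff_outer k T < top" for T :: "'a set"
  proof -
    define S where "S = (\<lambda>n::nat. {x\<in>T. inverse (real (Suc n)) \<le> infdist x F})"
    define R where "R = (\<lambda>n. S (Suc n) - S n)"
    have inv: "inverse (real (Suc n)) < inverse (real (Suc m))" if "m < n" for m n
      using that by (simp add: field_simps)
    have R_sep: "\<exists>d>0. \<forall>x\<in>R i. \<forall>y. y \<in> R j \<longrightarrow> d \<le> dist x y" if "Suc i < j" for i j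
    proof (intro exI conjI ballI allI impI)
      show "inverse (real (Suc (Suc i))) - inverse (real (Suc j)) > 0"
        using inv[OF that] by simp
      fix x y assume "x \<in> R i" "y \<in> R j"
      then have "inverse (real (Suc (Suc i))) \<le> infdist x F" "infdist y F < inverse (real (Suc j))"
        by (auto simp: R_def S_def)
      then show "inverse (real (Suc (Suc i))) - inverse (real (Suc j)) \<le> dist x y"
        using infdist_triangle[of x F y] by linarith
    qed
    have RT: "R i \<subseteq> T" for i by (auto simp: R_def S_def)
    have even: "(\<Sum>i. hausdorff_outer k (R (2 * i))) \<le> hausdorff_outer k T"
      and odd: "(\<Sum>i. hausdorff_outer k (R (2 * i + 1))) \<le> hausdorff_outer k T"
      by (rule hausdorff_outer_rings; use R_sep RT in auto)+
    have summ: "(\<Sum>i. hausdorff_outer k (R i)) \<le> hausdorff_outer k T + hausdorff_outer k T"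
    proof (rule suminf_le_const)
      fix n :: nat
      have "(\<Sum>i<n. hausdorff_outer k (R i)) \<le> (\<Sum>i<2 * n. hausdorff_outer k (R i))"
        by (rule sum_mono2) auto
      also have "\<dots> = (\<Sum>i<n. hausdorff_outer k (R (2 * i))) + (\<Sum>i<n. hausdorff_outer k (R (2 * i + 1)))"
        by (induction n) (auto simp: algebra_simps)
      also have "\<dots> \<le> hausdorff_outer k T + hausdorff_outer k T"
        by (intro add_mono order_trans[OF sum_le_suminf even] order_trans[OF sum_le_suminf odd]) auto
      finally show "(\<Sum>i<n. hausdorff_outer k (R i)) \<le> hausdorff_outer k T + hausdorff_outer k T" .
    qed simp
    have fin_sum: "(\<Sum>i. hausdorff_outer k (R i)) \<noteq> top"
    proof -
      have "hausdorff_outer k T + hausdorff_outer k T < top"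
        using fin by (simp add: less_top)
      with summ show ?thesis by (simp add: less_top order.strict_trans1)
    qed
    have step: "hausdorff_outer k (F \<inter> T) + hausdorff_outer k (T - F)
        \<le> hausdorff_outer k T + (\<Sum>i. hausdorff_outer k (R (i + n)))" for n
    proof -
      have cover: "T - F \<subseteq> S n \<union> (\<Union>i. R (i + n))"
      proof
        fix x assume x: "x \<in> T - F"
        then have "infdist x F > 0"
          using F nonempty by (simp add: infdist_pos_not_in_closed)
        then obtain m where "inverse (real (Suc m)) < infdist x F"
          using reals_Archimedean by blast
        then have ex: "x \<in> S m" using x by (simp add: S_def)
        define l where "l = (LEAST m. x \<in> S m)"
        have l: "x \<in> S l" "\<And>m. m < l \<Longrightarrow> x \<notin> S m"
          unfolding l_def by (rule LeastI[of "\<lambda>m. x \<in> S m", OF ex]) (rule not_less_Least)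
        show "x \<in> S n \<union> (\<Union>i. R (i + n))"
        proof (cases "l \<le> n")
          case True
          then have inv_le: "inverse (real (Suc n)) \<le> inverse (real (Suc l))"
            by (intro le_imp_inverse_le) auto
          then have "S l \<subseteq> S n"
            unfolding S_def using order_trans[OF inv_le] by blast
          then show ?thesis using l by auto
        next
          case False
          then have "x \<in> R ((l - 1 - n) + n)"
            using l(1) l(2)[of "l - 1"] by (auto simp: R_def)
          then show ?thesis by blast
        qed
      qed
      have "hausdorff_outer k (T - F) \<le> hausdorff_outer k (S n) + hausdorff_outer k (\<Union>i. R (i + n))"
        using hausdorff_outer_mono[OF cover] hausdorff_outer_Un_le order_trans by blast
      also have "\<dots> \<le> hausdorff_outer k (S n) + (\<Sum>i. hausdorff_outer k (R (i + n)))"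
        by (intro add_left_mono hausdorff_outer_countably_subadditive)
      finally have "hausdorff_outer k (F \<inter> T) + hausdorff_outer k (T - F)
          \<le> (hausdorff_outer k (F \<inter> T) + hausdorff_outer k (S n)) + (\<Sum>i. hausdorff_outer k (R (i + n)))"
        by (simp add: add.assoc add_left_mono)
      also have "hausdorff_outer k (F \<inter> T) + hausdorff_outer k (S n) \<le> hausdorff_outer k ((F \<inter> T) \<union> S n)"
      proof (rule hausdorff_outer_metric)
        show "inverse (real (Suc n)) > 0" by simp
        fix x y assume "x \<in> F \<inter> T" "y \<in> S n"
        then show "inverse (real (Suc n)) \<le> dist x y"
          using infdist_le[of x F y] by (auto simp: S_def dist_commute)
      qed
      also have "\<dots> \<le> hausdorff_outer k T"
        by (intro hausdorff_outer_mono) (auto simp: S_def)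
      finally show ?thesis by (simp add: add_right_mono)
    qed
    let ?X = "hausdorff_outer k (F \<inter> T) + hausdorff_outer k (T - F)"
    let ?S = "\<Sum>i. hausdorff_outer k (R i)"
    have "?X + (\<Sum>i<n. hausdorff_outer k (R i)) \<le> hausdorff_outer k T + ?S" for n
    proof -
      have "?S = (\<Sum>i. hausdorff_outer k (R (i + n))) + (\<Sum>i<n. hausdorff_outer k (R i))"
        by (rule suminf_offset) simp
      then show ?thesis
        using add_right_mono[OF step[of n], of "\<Sum>i<n. hausdorff_outer k (R i)"]
        by (simp add: add.assoc)
    qed
    moreover have "(\<lambda>n. ?X + (\<Sum>i<n. hausdorff_outer k (R i))) \<longlonglongrightarrow> ?X + ?S"
      by (intro tendsto_add tendsto_const summable_LIMSEQ) auto
    ultimately have "?X + ?S \<le> hausdorff_outer k T + ?S"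
      by (intro LIMSEQ_le_const2) auto
    then show ?thesis
      using fin_sum by (simp add: add.commute[of _ ?S] ennreal_add_left_cancel_le)
  qed
  have "hausdorff_outer k (F \<inter> T) + hausdorff_outer k ((UNIV - F) \<inter> T) = hausdorff_outer k T" for T
  proof -
    have eq: "(UNIV - F) \<inter> T = T - F" "(F \<inter> T) \<union> (T - F) = T" by auto
    have "hausdorff_outer k (F \<inter> T) + hausdorff_outer k (T - F) \<le> hausdorff_outer k T"
      using le[of T] top_greatest
      by (cases "hausdorff_outer k T = top") (simp_all add: less_top del: not_less)
    with hausdorff_outer_Un_le[of k "F \<inter> T" "T - F"] show ?thesis
      unfolding eq by (intro antisym) auto
  qed
  then show ?thesis by (simp add: lambda_system_def)
qed

lemma measure_space_hausdorff_outer: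
  "measure_space (UNIV :: 'a::metric_space set) (sets borel) (hausdorff_outer k)"
proof -
  let ?L = "lambda_system (UNIV :: 'a set) (Pow UNIV) (hausdorff_outer k)"
  have L: "measure_space UNIV ?L (hausdorff_outer k)"
    by (rule sigma_algebra.caratheodory_lemma[OF sigma_algebra_Pow outer_measure_space_hausdorff_outer])
  then have sa: "sigma_algebra UNIV ?L" by (simp add: measure_space_def)
  have "sets borel = sigma_sets UNIV {F :: 'a set. closed F}"
    by (simp add: borel_eq_closed)
  also have "\<dots> \<subseteq> ?L"
    by (rule sigma_algebra.sigma_sets_subset[OF sa])
       (use closed_in_lambda_system_hausdorff_outer in blast)
  finally show ?thesis
    using measure_down[OF L] sets.sigma_algebra_axioms[of "borel :: 'a measure"] by simp
qed

lemma space_hausdorff_measure [simp]: "space (hausdorff_measure k) = UNIV"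
  by (simp add: hausdorff_measure_def)

lemma sets_hausdorff_measure [simp, measurable_cong]: "sets (hausdorff_measure k) = sets borel"
  using sets.sigma_sets_eq[of borel] by (simp add: hausdorff_measure_def)

lemma emeasure_hausdorff_measure:
  assumes "A \<in> sets borel"
  shows "emeasure (hausdorff_measure k) A = hausdorff_outer k A"
proof -
  have "sigma_sets UNIV (sets borel) = sets (borel :: 'a measure)"
    using sets.sigma_sets_eq[of "borel :: 'a measure"] by simp
  then show ?thesis
    using measure_space_hausdorff_outer[where 'a='a] assms
    by (intro emeasure_measure_of[OF hausdorff_measure_def]) (auto simp: measure_space_def)
qed

subsection \<open>Point spread functions\<close>

text \<open>
  Lebesgue measurability is the most general reading of ``measurable''; for Borel functions,
  integrals over \<^const>\<open>lebesgue\<close> and \<^const>\<open>lborel\<close> coincide.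
\<close>

definition psf :: "('a::euclidean_space \<Rightarrow> real) \<Rightarrow> bool" where
  "psf \<rho> \<longleftrightarrow>
     \<rho> \<in> borel_measurable lebesgue \<and> (\<forall>z. 0 \<le> \<rho> z) \<and> (LINT z|lebesgue. \<rho> z) = 1"

definition blurred :: "('a::euclidean_space \<Rightarrow> real) \<Rightarrow> real \<Rightarrow> 'a set \<Rightarrow> 'a \<Rightarrow> real" where
  "blurred \<rho> a X x =
     (1 / a ^ DIM('a)) * (LINT z:X|lebesgue. \<rho> ((1 / a) *\<^sub>R (z - x)))"

subsection \<open>Lattices\<close>

definition is_basis :: "(nat \<Rightarrow> 'a::euclidean_space) \<Rightarrow> bool" where
  "is_basis v \<longleftrightarrow>
     inj_on v {1..DIM('a)} \<and> independent (v ` {1..DIM('a)}) \<and> span (v ` {1..DIM('a)}) = UNIV"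

definition lattice_of :: "(nat \<Rightarrow> 'a::euclidean_space) \<Rightarrow> 'a set" where
  "lattice_of v = {(\<Sum>i=1..DIM('a). of_int (m i) *\<^sub>R v i) | m :: nat \<Rightarrow> int. True}"

definition fundamental_cell :: "(nat \<Rightarrow> 'a::euclidean_space) \<Rightarrow> 'a set" where
  "fundamental_cell v =
     {(\<Sum>i=1..DIM('a). l i *\<^sub>R v i) | l :: nat \<Rightarrow> real. \<forall>i\<in>{1..DIM('a)}. 0 \<le> l i \<and> l i < 1}"

definition scaled_shifted_lattice :: "(nat \<Rightarrow> 'a::euclidean_space) \<Rightarrow> real \<Rightarrow> 'a \<Rightarrow> 'a set" where
  "scaled_shifted_lattice v a c = (\<lambda>z. a *\<^sub>R (z + c)) ` lattice_of v"

subsection \<open>Volume tensors and their estimator\<close>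

text \<open>
  A rank \<open>r\<close> tensor is represented by its \<open>r\<close>-linear functional; the arguments
  \<open>w\<^sub>1, \<dots>, w\<^sub>r\<close> are the values at \<open>1, \<dots>, r\<close> of \<open>w :: nat \<Rightarrow> 'a\<close>, and the other values of
  \<open>w\<close> are ignored.  Sums, integrals and expectations of tensors are therefore evaluated
  pointwise in \<open>w\<close>.  The library topology on functions is that of pointwise convergence,
  which on the finite-dimensional space of \<open>r\<close>-linear functionals is the usual one.
\<close>

type_synonym 'a tensor = "(nat \<Rightarrow> 'a) \<Rightarrow> real"

definition tensor_power :: "'a::euclidean_space \<Rightarrow> nat \<Rightarrow> 'a tensor" where
  "tensor_power x r = (\<lambda>w. \<Prod>k=1..r. x \<bullet> w k)"

definition volume_tensor :: "nat \<Rightarrow> 'a::euclidean_space set \<Rightarrow> 'a tensor" where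
  "volume_tensor r X =
     (\<lambda>w. (1 / fact r) * (LINT x:X|hausdorff_measure DIM('a). tensor_power x r w))"

text \<open>
  The sum over the lattice has only finitely many nonzero terms when \<open>X\<close> is bounded and
  \<open>\<beta> > 0\<close>, since then the blurred image of \<open>X\<close> tends to 0 at infinity.
\<close>

definition volume_tensor_estimator ::
  "('a::euclidean_space \<Rightarrow> real) \<Rightarrow> (nat \<Rightarrow> 'a) \<Rightarrow> real \<Rightarrow> nat \<Rightarrow> real \<Rightarrow> 'a set \<Rightarrow> 'a \<Rightarrow> 'a tensor"
where
  "volume_tensor_estimator \<rho> v \<beta> r a X c =
     (\<lambda>w. a ^ DIM('a) * (1 / fact r) *
        (\<Sum>\<^sub>\<infinity>z\<in>scaled_shifted_lattice v a c.
           indicator {z. blurred \<rho> a X z \<ge> \<beta>} z * tensor_power z r w))"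

definition expected_estimator ::
  "('a::euclidean_space \<Rightarrow> real) \<Rightarrow> (nat \<Rightarrow> 'a) \<Rightarrow> real \<Rightarrow> nat \<Rightarrow> real \<Rightarrow> 'a set \<Rightarrow> 'a tensor"
where
  "expected_estimator \<rho> v \<beta> r a X =
     (\<lambda>w. LINT c|uniform_measure lebesgue (fundamental_cell v).
        volume_tensor_estimator \<rho> v \<beta> r a X c w)"

end

theory Submission
  imports Defs
begin

text \<open>
  The superlevel sets \<open>{\<theta>\<^sub>a \<ge> \<beta>}\<close>, \<open>a \<le> 1\<close>, are uniformly bounded, and averaging over the shift
  of the lattice turns the estimator into the integral of \<open>x\<^sup>r / r!\<close> over such a set.  Off the
  frontier of \<open>X\<close>, the blurred image converges pointwise to the indicator of \<open>X\<close>, and the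
  frontier is a Lebesgue null set, so dominated convergence gives the Lebesgue integral over \<open>X\<close>.

  The volume tensor integrates over \<open>d\<close>-dimensional Hausdorff measure, so Hausdorff and Lebesgue
  measure must be identified.  Vitali coverings give one inequality.  The other one is the
  isodiametric inequality: every midpoint of \<open>K\<close> and \<open>- K\<close> has norm at most half the diameter
  of \<open>K\<close>, so it follows from the multiplicative Brunn-Minkowski inequality, which comes
  from the Prekopa-Leindler inequality by induction on the dimension.
\<close>

subsection \<open>The one-dimensional Brunn-Minkowski inequality\<close>

lemma emeasure_lborel_vimage_plus:
  fixes c :: "'a::euclidean_space"
  assumes "A \<in> sets borel"
  shows "emeasure lborel ((+) c -` A) = emeasure lborel A"
proof -
  have "emeasure lborel A = emeasure (distr lborel borel ((+) c)) A"
    by (simp add: lborel_distr_plus)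
  also have "\<dots> = emeasure lborel ((+) c -` A)"
    using assms by (subst emeasure_distr) auto
  finally show ?thesis ..
qed

lemma emeasure_lborel_image_plus:
  fixes c :: "'a::euclidean_space"
  assumes "A \<in> sets borel"
  shows "emeasure lborel ((+) c ` A) = emeasure lborel A"
proof -
  have "(+) c ` A = (+) (- c) -` A"
    by (force simp: image_iff algebra_simps)
  then show ?thesis
    using emeasure_lborel_vimage_plus[OF assms, of "- c"] by simp
qed

lemma emeasure_lborel_compact_Minkowski_real:
  fixes A B C :: "real set"
  assumes A: "compact A" "A \<noteq> {}" and B: "compact B" "B \<noteq> {}" and C: "C \<in> sets borel"
    and sum: "\<And>x y. x \<in> A \<Longrightarrow> y \<in> B \<Longrightarrow> x + y \<in> C"
  shows "emeasure lborel A + emeasure lborel B \<le> emeasure lborel C"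
proof -
  obtain a where a: "a \<in> A" "\<And>x. x \<in> A \<Longrightarrow> x \<le> a"
    using compact_attains_sup[OF A] by blast
  obtain b where b: "b \<in> B" "\<And>x. x \<in> B \<Longrightarrow> b \<le> x"
    using compact_attains_inf[OF B] by blast
  \<comment> \<open>The translate of \<open>A\<close> by the least point of \<open>B\<close> ends at
    \<open>a + b\<close>, exactly where the translate of \<open>B\<close> by the greatest point of
    \<open>A\<close> begins. Both translates lie in \<open>C\<close>, and dropping the shared point
    makes them disjoint at no cost in measure.\<close>
  let ?P = "(+) b ` A" and ?Q = "(+) a ` B - {a + b}"
  have P: "?P \<in> sets borel" and Q: "(+) a ` B \<in> sets borel"
    using A(1) B(1) by (auto intro!: borel_compact compact_translation)
  have "emeasure lborel A + emeasure lborel B = emeasure lborel ?P + emeasure lborel ((+) a ` B)"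
    using A(1) B(1) by (simp add: emeasure_lborel_image_plus borel_compact)
  also have "emeasure lborel ((+) a ` B) = emeasure lborel ?Q"
    using Q by (intro emeasure_Diff_null_set[symmetric]) (auto simp: null_sets_def)
  also have "emeasure lborel ?P + emeasure lborel ?Q = emeasure lborel (?P \<union> ?Q)"
    using P Q a b by (intro plus_emeasure) (force simp: add.commute)+
  also have "\<dots> \<le> emeasure lborel C"
    using sum[OF _ b(1)] sum[OF a(1)] C by (intro emeasure_mono) (auto simp: add.commute[of b])
  finally show ?thesis .
qed

text \<open>\<open>inner_regular\<close> is applied to a finite measure: \<open>M\<close> is
  Lebesgue measure cut down to a ball so large that the part of \<open>A\<close> inside it still has
  measure above \<open>t\<close>.\<close>

lemma emeasure_lborel_inner_compact:
  fixes A :: "'a::euclidean_space set"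
  assumes A: "A \<in> sets borel" and t: "t < emeasure lborel A"
  obtains K where "compact K" "K \<subseteq> A" "t < emeasure lborel K"
proof -
  have "(SUP n. emeasure lborel (A \<inter> cball 0 (real n))) = emeasure lborel (\<Union>n. A \<inter> cball 0 (real n))"
    using A by (intro SUP_emeasure_incseq) (auto simp: incseq_def)
  also have "(\<Union>n. A \<inter> cball 0 (real n)) = A"
    using real_arch_simple by auto
  finally have "t < (SUP n. emeasure lborel (A \<inter> cball 0 (real n)))"
    using t by simp
  then obtain n :: nat where n: "t < emeasure lborel (A \<inter> cball 0 (real n))"
    unfolding less_SUP_iff by blast
  define M where "M = density lborel (indicator (cball (0::'a) (real n)))"
  have [measurable]: "indicator (cball 0 (real n)) \<in> borel_measurable (borel :: 'a measure)"
    by (intro borel_measurable_indicator) auto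
  have M: "emeasure M S = emeasure lborel (S \<inter> cball 0 (real n))" if "S \<in> sets borel" for S
    using that unfolding M_def
    by (subst emeasure_density) (auto simp: nn_integral_indicator[symmetric] indicator_inter_arith mult.commute
        simp del: nn_integral_indicator intro!: nn_integral_cong)
  have "emeasure M (space M) \<noteq> \<infinity>"
    using M[of UNIV] emeasure_lborel_cball_finite[of 0 "real n"] by (simp add: M_def less_top)
  then have "emeasure M A = (SUP K \<in> {K. K \<subseteq> A \<and> compact K}. emeasure M K)"
    using A by (intro inner_regular) (auto simp: M_def)
  then obtain K where K: "K \<subseteq> A" "compact K" "t < emeasure M K"
    using n M[OF A] by (auto simp: less_SUP_iff)
  have "t < emeasure lborel (K \<inter> cball 0 (real n))"
    using K M[of K] by (simp add: borel_compact)
  also have "\<dots> \<le> emeasure lborel K"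
    using K by (intro emeasure_mono) (auto simp: borel_compact)
  finally show ?thesis using K that by blast
qed

text \<open>Exhausts \<open>A\<close> and \<open>B\<close> from inside by compact sets. The set
  \<open>C\<close> stands in for the sumset, which need not be Borel.\<close>

lemma emeasure_lborel_Minkowski_real:
  fixes A B C :: "real set"
  assumes A: "A \<in> sets borel" "A \<noteq> {}" and B: "B \<in> sets borel" "B \<noteq> {}" and C: "C \<in> sets borel"
    and sum: "\<And>x y. x \<in> A \<Longrightarrow> y \<in> B \<Longrightarrow> x + y \<in> C"
  shows "emeasure lborel A + emeasure lborel B \<le> emeasure lborel C"
proof -
  \<comment> \<open>The alternative \<open>t = 0\<close> covers nonempty null sets, for which no
    \<open>t\<close> lies below the measure; a singleton then serves as the compact set.\<close>
  have approx: "\<exists>K. compact K \<and> K \<noteq> {} \<and> K \<subseteq> D \<and> t \<le> emeasure lborel K"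
    if D: "D \<in> sets borel" "D \<noteq> {}" "t < emeasure lborel D \<or> t = 0" for D :: "real set" and t
  proof (cases "t < emeasure lborel D")
    case True
    then obtain K where K: "compact K" "K \<subseteq> D" "t < emeasure lborel K"
      using emeasure_lborel_inner_compact[OF D(1)] by blast
    then have "K \<noteq> {}" by auto
    with K show ?thesis by (intro exI[of _ K]) auto
  next
    case False
    obtain x where "x \<in> D" using D by auto
    then show ?thesis using False D by (intro exI[of _ "{x}"]) auto
  qed
  have step: "s + t \<le> emeasure lborel C"
    if st: "s < emeasure lborel A \<or> s = 0" "t < emeasure lborel B \<or> t = 0" for s t
  proof -
    obtain K where K: "compact K" "K \<noteq> {}" "K \<subseteq> A" "s \<le> emeasure lborel K"
      using approx[OF A st(1)] by blast
    obtain L where L: "compact L" "L \<noteq> {}" "L \<subseteq> B" "t \<le> emeasure lborel L"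
      using approx[OF B st(2)] by blast
    have "s + t \<le> emeasure lborel K + emeasure lborel L"
      using K L by (intro add_mono)
    also have "\<dots> \<le> emeasure lborel C"
      using K L sum by (intro emeasure_lborel_compact_Minkowski_real C) auto
    finally show ?thesis .
  qed
  have SUP: "(SUP s\<in>{s. s < u \<or> s = 0}. s) = u" for u :: ennreal
  proof (rule antisym)
    show "u \<le> (SUP s\<in>{s. s < u \<or> s = 0}. s)"
    proof (rule dense_le)
      fix s assume "s < u"
      then show "s \<le> (SUP s\<in>{s. s < u \<or> s = 0}. s)"
        by (intro SUP_upper) auto
    qed
  next
    show "(SUP s\<in>{s. s < u \<or> s = 0}. s) \<le> u"
      by (rule SUP_least) auto
  qed
  have ne: "{s. s < u \<or> s = 0} \<noteq> {}" for u :: ennreal by auto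
  have "(SUP s\<in>{s. s < emeasure lborel A \<or> s = 0}. s) + (SUP t\<in>{t. t < emeasure lborel B \<or> t = 0}. t)
      \<le> emeasure lborel C"
    by (subst ennreal_SUP_add_left[OF ne, symmetric], rule SUP_least,
        subst ennreal_SUP_add_right[OF ne], rule SUP_least) (use step in auto)
  then show ?thesis by (simp only: SUP)
qed

subsection \<open>The Prekopa-Leindler inequality on the real line\<close>

text \<open>The value \<open>f x\<close> is the length of the set of \<open>t \<ge> 0\<close> with
  \<open>t < f x\<close>; Tonelli exchanges the two integrations.\<close>

lemma nn_integral_layer_cake:
  fixes f :: "real \<Rightarrow> ennreal"
  assumes [measurable]: "f \<in> borel_measurable borel"
  shows "(\<integral>\<^sup>+x. f x \<partial>lborel)
      = (\<integral>\<^sup>+t. indicator {0..} t * emeasure lborel {x. ennreal t < f x} \<partial>lborel)"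
proof -
  have "f x = (\<integral>\<^sup>+t. indicator {0..} t * indicator {x. ennreal t < f x} x \<partial>lborel)" for x
  proof -
    have "(\<integral>\<^sup>+t. indicator {0..} t * indicator {x. ennreal t < f x} x \<partial>lborel)
        = (\<integral>\<^sup>+t. indicator {t. 0 \<le> t \<and> ennreal t < f x} t \<partial>lborel)"
      by (intro nn_integral_cong) (auto simp: indicator_def)
    also have "\<dots> = emeasure lborel {t. 0 \<le> t \<and> ennreal t < f x}"
      by (intro nn_integral_indicator) measurable
    also have "\<dots> = f x"
    proof (cases "f x")
      case (real r)
      then have "{t. 0 \<le> t \<and> ennreal t < f x} = {0..<r}"
        by (auto simp: ennreal_less_iff)
      then show ?thesis using real by simp
    next
      case top
      then have "{t. 0 \<le> t \<and> ennreal t < f x} = {0..}" by auto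
      moreover have "emeasure lborel {0::real..} = top"
      proof -
        have "of_nat n \<le> emeasure lborel {0::real..}" for n
          using emeasure_mono[of "{0..real n}" "{0..}" lborel] by (simp add: ennreal_of_nat_eq_real_of_nat)
        then have "(SUP n. of_nat n) \<le> emeasure lborel {0::real..}"
          by (rule SUP_least)
        then show ?thesis by (simp add: ennreal_SUP_of_nat_eq_top top_unique)
      qed
      ultimately show ?thesis using top by simp
    qed
    finally show ?thesis ..
  qed
  then have "(\<integral>\<^sup>+x. f x \<partial>lborel)
      = (\<integral>\<^sup>+x. (\<integral>\<^sup>+t. indicator {0..} t * indicator {x. ennreal t < f x} x \<partial>lborel) \<partial>lborel)"
    by (rule nn_integral_cong)
  also have "\<dots> = (\<integral>\<^sup>+t. (\<integral>\<^sup>+x. indicator {0..} t * indicator {x. ennreal t < f x} x \<partial>lborel) \<partial>lborel)"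
  proof (rule lborel_pair.Fubini'[symmetric])
    have "Measurable.pred (borel \<Otimes>\<^sub>M borel) (\<lambda>p. ennreal (snd p) < f (fst p))"
      by measurable
    then have "(\<lambda>p. indicator {0..} (snd p) * indicator {p. ennreal (snd p) < f (fst p)} p :: ennreal)
        \<in> borel_measurable (borel \<Otimes>\<^sub>M borel)"
      by (intro borel_measurable_times_ennreal) (auto intro!: borel_measurable_indicator simp: pred_def)
    then show "(\<lambda>(x, t). indicator {0..} t * indicator {x. ennreal t < f x} x :: ennreal)
        \<in> borel_measurable (lborel \<Otimes>\<^sub>M lborel)"
      by (simp add: case_prod_beta indicator_def cong: measurable_cong_sets)
  qed
  also have "\<dots> = (\<integral>\<^sup>+t. indicator {0..} t * emeasure lborel {x. ennreal t < f x} \<partial>lborel)"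
    by (intro nn_integral_cong) (simp add: nn_integral_cmult)
  finally show ?thesis .
qed

text \<open>With both suprema equal to 1, the superlevel sets of \<open>f\<close> and
  \<open>g\<close> at a level \<open>t < 1\<close> are nonempty, and midpoints of their points lie
  in the superlevel set of \<open>h\<close>. The one-dimensional Brunn-Minkowski inequality thus
  applies at each level, and the layer cake formula integrates it over \<open>t\<close>.\<close>

lemma Prekopa_Leindler_real_normalized:
  fixes f g h :: "real \<Rightarrow> ennreal"
  assumes [measurable]: "f \<in> borel_measurable borel" "g \<in> borel_measurable borel" "h \<in> borel_measurable borel"
    and f1: "\<And>x. f x \<le> 1" and g1: "\<And>x. g x \<le> 1"
    and f_sup: "\<And>t. 0 \<le> t \<Longrightarrow> t < 1 \<Longrightarrow> \<exists>x. ennreal t < f x"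
    and g_sup: "\<And>t. 0 \<le> t \<Longrightarrow> t < 1 \<Longrightarrow> \<exists>x. ennreal t < g x"
    and fgh: "\<And>x y. f x * g y \<le> (h ((x + y) / 2))\<^sup>2"
  shows "(\<integral>\<^sup>+x. f x \<partial>lborel) + (\<integral>\<^sup>+x. g x \<partial>lborel) \<le> 2 * (\<integral>\<^sup>+x. h x \<partial>lborel)"
proof -
  have level: "emeasure lborel {x. ennreal t < f x} + emeasure lborel {x. ennreal t < g x}
      \<le> 2 * emeasure lborel {x. ennreal t < h x}" if t: "0 \<le> t" for t
  proof (cases "t < 1")
    case True
    \<comment> \<open>The superlevel set of \<open>h\<close> stretched by 2, because the hypothesis
      concerns midpoints and the Minkowski bound concerns sums. This is the source of the factor
      2.\<close>
    let ?C = "{z. ennreal t < h (z / 2)}"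
    have half: "2 * ennreal \<bar>1/2\<bar> = 1"
      by (subst numeral_mult_ennreal) auto
    have "x + y \<in> ?C" if "ennreal t < f x" "ennreal t < g y" for x y
    proof (rule ccontr)
      assume "x + y \<notin> ?C"
      then have "(h ((x + y) / 2))\<^sup>2 \<le> ennreal t * ennreal t"
        unfolding power2_eq_square by (intro mult_mono) auto
      moreover have "ennreal t * ennreal t < f x * g y"
      \<comment> \<open>Multiplying a strict inequality by \<open>t\<close> keeps it strict only for
        \<open>t > 0\<close>; at \<open>t = 0\<close> both factors on the right are
        positive.\<close>
      proof (cases "t = 0")
        case True
        then show ?thesis using that by (simp add: ennreal_zero_less_mult_iff)
      next
        case False
        then have "ennreal t * ennreal t < f x * ennreal t"
          using that t by (intro ennreal_mult_strict_right_mono) auto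
        also have "\<dots> \<le> f x * g y"
          using that by (intro mult_left_mono) auto
        finally show ?thesis .
      qed
      ultimately show False using fgh[of x y] by (auto simp: not_less)
    qed
    then have "emeasure lborel {x. ennreal t < f x} + emeasure lborel {x. ennreal t < g x} \<le> emeasure lborel ?C"
      using f_sup[OF t True] g_sup[OF t True]
      by (intro emeasure_lborel_Minkowski_real) (auto, measurable)
    also have "\<dots> = (\<integral>\<^sup>+z. indicator {x. ennreal t < h x} (0 + (1/2) * z) \<partial>lborel)"
    proof -
      have "?C \<in> sets lborel" by measurable
      then have "emeasure lborel ?C = (\<integral>\<^sup>+z. indicator ?C z \<partial>lborel)"
        by (rule nn_integral_indicator[symmetric])
      also have "\<dots> = (\<integral>\<^sup>+z. indicator {x. ennreal t < h x} (0 + (1/2) * z) \<partial>lborel)"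
        by (intro nn_integral_cong) (simp add: indicator_def)
      finally show ?thesis .
    qed
    also have "\<dots> = 2 * (ennreal \<bar>1/2\<bar> * (\<integral>\<^sup>+z. indicator {x. ennreal t < h x} (0 + (1/2) * z) \<partial>lborel))"
      by (simp only: mult.assoc[symmetric] half mult_1)
    also have "ennreal \<bar>1/2\<bar> * (\<integral>\<^sup>+z. indicator {x. ennreal t < h x} (0 + (1/2) * z) \<partial>lborel)
        = (\<integral>\<^sup>+z. indicator {x. ennreal t < h x} z \<partial>lborel)"
      by (rule nn_integral_real_affine[symmetric]) auto
    finally show ?thesis by simp
  next
    case False
    then have t1: "1 \<le> ennreal t" by simp
    have "{x. ennreal t < f x} = {}" "{x. ennreal t < g x} = {}"
      using order_trans[OF f1 t1] order_trans[OF g1 t1] by (simp_all add: not_less)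
    then show ?thesis by simp
  qed
  have meas: "(\<lambda>t. emeasure lborel {x. ennreal t < k x}) \<in> borel_measurable borel"
    if [measurable]: "k \<in> borel_measurable borel" for k :: "real \<Rightarrow> ennreal"
    by measurable
  note [measurable] = meas[of f] meas[of g] meas[of h]
  have "(\<integral>\<^sup>+x. f x \<partial>lborel) + (\<integral>\<^sup>+x. g x \<partial>lborel)
      = (\<integral>\<^sup>+t. indicator {0..} t * (emeasure lborel {x. ennreal t < f x}
          + emeasure lborel {x. ennreal t < g x}) \<partial>lborel)"
    unfolding nn_integral_layer_cake[of f, OF assms(1)] nn_integral_layer_cake[of g, OF assms(2)] distrib_left
    by (rule nn_integral_add[symmetric]) auto
  also have "\<dots> \<le> (\<integral>\<^sup>+t. 2 * (indicator {0..} t * emeasure lborel {x. ennreal t < h x}) \<partial>lborel)"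
    using level by (intro nn_integral_mono) (auto simp: indicator_def)
  also have "\<dots> = 2 * (\<integral>\<^sup>+x. h x \<partial>lborel)"
    unfolding nn_integral_layer_cake[of h, OF assms(3)] by (rule nn_integral_cmult) auto
  finally show ?thesis .
qed

text \<open>Turns the additive inequality for normalized functions into the multiplicative one. For
  finite values it rests on \<open>4ab = (a + b)^2 - (a - b)^2\<close>.\<close>

lemma ennreal_am_gm:
  fixes p q w :: ennreal
  assumes "p + q \<le> 2 * w"
  shows "p * q \<le> w\<^sup>2"
proof (cases "w = top")
  case True
  then show ?thesis by (simp add: power2_eq_square)
next
  case False
  then obtain u where u: "w = ennreal u" "0 \<le> u" by (cases w) auto
  have "2 * w < top" using u by (simp add: ennreal_mult_less_top)
  then have "p < top" "q < top" using assms by (auto simp: less_top[symmetric] top_unique)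
  then obtain a b where ab: "p = ennreal a" "q = ennreal b" "0 \<le> a" "0 \<le> b"
    by (cases p; cases q) auto
  have "ennreal (a + b) \<le> ennreal (2 * u)"
    using assms ab u by (simp add: ennreal_mult)
  then have le: "a + b \<le> 2 * u" using u by (simp add: ennreal_le_iff)
  have "(2 * u)\<^sup>2 \<ge> (a + b)\<^sup>2" using le ab by (intro power_mono) auto
  moreover have "(a + b)\<^sup>2 - 4 * (a * b) = (a - b)\<^sup>2"
    by (simp add: power2_eq_square algebra_simps)
  moreover have "(2 * u)\<^sup>2 = 4 * u\<^sup>2" by (simp add: power_mult_distrib)
  ultimately have "a * b \<le> u\<^sup>2"
    using zero_le_power2[of "a - b"] by linarith
  then show ?thesis using ab u by (simp add: ennreal_mult[symmetric] ennreal_power ennreal_leI)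
qed

text \<open>Boundedness makes the suprema \<open>a\<close> and \<open>b\<close> of \<open>f\<close>
  and \<open>g\<close> finite. Dividing \<open>f\<close> by \<open>a\<close>, \<open>g\<close> by
  \<open>b\<close> and \<open>h\<close> by \<open>sqrt (a * b)\<close> preserves the hypothesis and
  normalizes the suprema; in the multiplicative conclusion the factor \<open>1 / (a * b)\<close>
  cancels.\<close>

lemma Prekopa_Leindler_real_bounded:
  fixes f g h :: "real \<Rightarrow> ennreal"
  assumes [measurable]: "f \<in> borel_measurable borel" "g \<in> borel_measurable borel" "h \<in> borel_measurable borel"
    and f_le: "\<And>x. f x \<le> of_nat m" and g_le: "\<And>x. g x \<le> of_nat n"
    and fgh: "\<And>x y. f x * g y \<le> (h ((x + y) / 2))\<^sup>2"
  shows "(\<integral>\<^sup>+x. f x \<partial>lborel) * (\<integral>\<^sup>+x. g x \<partial>lborel) \<le> (\<integral>\<^sup>+x. h x \<partial>lborel)\<^sup>2"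
proof (cases "(\<forall>x. f x = 0) \<or> (\<forall>x. g x = 0)")
  case True
  then show ?thesis by auto
next
  case False
  have sup: "\<exists>a. 0 < a \<and> (\<forall>x. ennreal (1 / a) * k x \<le> 1)
      \<and> (\<forall>t. 0 \<le> t \<longrightarrow> t < 1 \<longrightarrow> (\<exists>x. ennreal t < ennreal (1 / a) * k x))"
    if le: "\<And>x. k x \<le> of_nat m" and nz: "\<exists>x. k x \<noteq> 0" for k :: "real \<Rightarrow> ennreal" and m
  proof -
    have "(SUP x. k x) \<le> of_nat m" using le by (intro SUP_least)
    then have "(SUP x. k x) < top" by (rule order.strict_trans1) (rule of_nat_less_top)
    then obtain a where a: "(SUP x. k x) = ennreal a" "0 \<le> a"
      by (cases "SUP x. k x") auto
    obtain x0 where "k x0 \<noteq> 0" using nz by auto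
    moreover have ka: "k x \<le> ennreal a" for x using a(1) by (metis SUP_upper UNIV_I)
    ultimately have "a \<noteq> 0" using ka[of x0] by auto
    with a have a0: "a > 0" by simp
    have inv: "ennreal (1 / a) * ennreal (t * a) = ennreal t" if "0 \<le> t" for t
      using a0 that by (simp add: ennreal_mult'[symmetric])
    have le1: "ennreal (1 / a) * k x \<le> 1" for x
      using mult_left_mono[OF ka[of x], of "ennreal (1 / a)"] inv[of 1] by simp
    have "\<exists>x. ennreal t < ennreal (1 / a) * k x" if t: "0 \<le> t" "t < 1" for t
    proof -
      have "ennreal (t * a) < (SUP x. k x)"
        using a0 t unfolding a(1) by (simp add: ennreal_less_iff)
      then obtain x where x: "ennreal (t * a) < k x"
        unfolding less_SUP_iff by auto
      have "ennreal t < ennreal (1 / a) * k x"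
        unfolding inv[OF t(1), symmetric] not_le[symmetric]
        using x a0 by (subst ennreal_mult_le_mult_iff) auto
      then show ?thesis ..
    qed
    with a0 le1 show ?thesis by blast
  qed
  obtain a where a: "0 < a" "\<And>x. ennreal (1 / a) * f x \<le> 1"
    "\<And>t. 0 \<le> t \<Longrightarrow> t < 1 \<Longrightarrow> \<exists>x. ennreal t < ennreal (1 / a) * f x"
    using sup[of f m, OF f_le] False by blast
  obtain b where b: "0 < b" "\<And>x. ennreal (1 / b) * g x \<le> 1"
    "\<And>t. 0 \<le> t \<Longrightarrow> t < 1 \<Longrightarrow> \<exists>x. ennreal t < ennreal (1 / b) * g x"
    using sup[of g n, OF g_le] False by blast
  define c where "c = sqrt (a * b)"
  have c: "c > 0" "c * c = a * b" using a(1) b(1) by (auto simp: c_def)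
  have prod: "ennreal (1 / a) * p * (ennreal (1 / b) * q) = ennreal (1 / (a * b)) * (p * q)" for p q
    using a(1) b(1) by (simp add: ennreal_mult[of "1/a" "1/b", symmetric] mult_ac flip: mult.assoc)
  have sq: "(ennreal (1 / c) * p)\<^sup>2 = ennreal (1 / (a * b)) * p\<^sup>2" for p
    using c a(1) b(1) by (simp add: power_mult_distrib ennreal_power power2_eq_square[of c] power_divide)
  have "(\<integral>\<^sup>+x. ennreal (1 / a) * f x \<partial>lborel) + (\<integral>\<^sup>+x. ennreal (1 / b) * g x \<partial>lborel)
      \<le> 2 * (\<integral>\<^sup>+x. ennreal (1 / c) * h x \<partial>lborel)"
    by (rule Prekopa_Leindler_real_normalized) (use a b in \<open>auto simp: prod sq intro!: mult_left_mono fgh\<close>)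
  then have "ennreal (1 / a) * (\<integral>\<^sup>+x. f x \<partial>lborel) * (ennreal (1 / b) * (\<integral>\<^sup>+x. g x \<partial>lborel))
      \<le> (ennreal (1 / c) * (\<integral>\<^sup>+x. h x \<partial>lborel))\<^sup>2"
    by (intro ennreal_am_gm) (simp add: nn_integral_cmult)
  then show ?thesis
    unfolding prod sq using a(1) b(1) by (subst (asm) ennreal_mult_le_mult_iff) auto
qed

lemma nn_integral_eq_SUP_min_of_nat:
  fixes f :: "'a \<Rightarrow> ennreal"
  assumes [measurable]: "f \<in> borel_measurable M"
  shows "(\<integral>\<^sup>+x. f x \<partial>M) = (SUP n. \<integral>\<^sup>+x. min (f x) (of_nat n) \<partial>M)"
proof -
  have "(SUP n. min (f x) (of_nat n)) = f x" for x
  proof -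
    have "(SUP n. min (f x) (of_nat n)) = inf (f x) (SUP n. of_nat n)"
      unfolding inf_SUP by (simp add: inf_min)
    then show ?thesis by (simp add: ennreal_SUP_of_nat_eq_top)
  qed
  then have "(\<integral>\<^sup>+x. f x \<partial>M) = (\<integral>\<^sup>+x. (SUP n. min (f x) (of_nat n)) \<partial>M)" by simp
  also have "\<dots> = (SUP n. \<integral>\<^sup>+x. min (f x) (of_nat n) \<partial>M)"
    by (intro nn_integral_monotone_convergence_SUP)
       (auto simp: incseq_def le_fun_def intro!: min.coboundedI2 of_nat_mono)
  finally show ?thesis .
qed

text \<open>Truncating \<open>f\<close> and \<open>g\<close> only lowers the left side of the
  hypothesis, so the bounded case applies; the truncation levels \<open>m\<close> and
  \<open>n\<close> then grow independently.\<close>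

theorem Prekopa_Leindler_real:
  fixes f g h :: "real \<Rightarrow> ennreal"
  assumes [measurable]: "f \<in> borel_measurable borel" "g \<in> borel_measurable borel" "h \<in> borel_measurable borel"
    and fgh: "\<And>x y. f x * g y \<le> (h ((x + y) / 2))\<^sup>2"
  shows "(\<integral>\<^sup>+x. f x \<partial>lborel) * (\<integral>\<^sup>+x. g x \<partial>lborel) \<le> (\<integral>\<^sup>+x. h x \<partial>lborel)\<^sup>2"
proof -
  have "(\<integral>\<^sup>+x. min (f x) (of_nat m) \<partial>lborel) * (\<integral>\<^sup>+x. min (g x) (of_nat n) \<partial>lborel)
      \<le> (\<integral>\<^sup>+x. h x \<partial>lborel)\<^sup>2" for m n
    by (rule Prekopa_Leindler_real_bounded[of _ _ _ m n])
       (auto intro: order_trans[OF mult_mono fgh])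
  then show ?thesis
    by (subst (1 2) nn_integral_eq_SUP_min_of_nat)
       (auto simp: SUP_mult_left_ennreal SUP_mult_right_ennreal intro!: SUP_least)
qed

subsection \<open>The isodiametric inequality\<close>

text \<open>Induction on the number of coordinates. By the induction hypothesis, the integrals of
  the slices over the old coordinates, as functions of the new one, satisfy the hypothesis of the
  real-line case; Tonelli reassembles the full integrals. Only extensional functions matter because
  these are the points of the product space.\<close>

lemma Prekopa_Leindler_PiM:
  fixes f g h :: "('i \<Rightarrow> real) \<Rightarrow> ennreal"
  assumes "finite I"
    and "f \<in> borel_measurable (Pi\<^sub>M I (\<lambda>_. lborel))" "g \<in> borel_measurable (Pi\<^sub>M I (\<lambda>_. lborel))"
      "h \<in> borel_measurable (Pi\<^sub>M I (\<lambda>_. lborel))"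
    and "\<And>x y. x \<in> extensional I \<Longrightarrow> y \<in> extensional I \<Longrightarrow>
           f x * g y \<le> (h (\<lambda>i\<in>I. (x i + y i) / 2))\<^sup>2"
  shows "(\<integral>\<^sup>+x. f x \<partial>Pi\<^sub>M I (\<lambda>_. lborel)) * (\<integral>\<^sup>+x. g x \<partial>Pi\<^sub>M I (\<lambda>_. lborel))
      \<le> (\<integral>\<^sup>+x. h x \<partial>Pi\<^sub>M I (\<lambda>_. lborel))\<^sup>2"
  using assms
proof (induction I arbitrary: f g h rule: finite_induct)
  case empty
  interpret product_sigma_finite "\<lambda>_::'i. lborel :: real measure" by standard
  have "f (\<lambda>_. undefined) * g (\<lambda>_. undefined) \<le> (h (\<lambda>_. undefined))\<^sup>2"
    using empty(4)[of "\<lambda>_. undefined" "\<lambda>_. undefined"] by (simp add: restrict_def)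
  then show ?case by (simp add: PiM_empty nn_integral_count_space_finite)
next
  case (insert i I)
  interpret product_sigma_finite "\<lambda>_::'i. lborel :: real measure" by standard
  interpret I: finite_product_sigma_finite "\<lambda>_::'i. lborel :: real measure" I
    by standard (rule insert)
  note [measurable] = insert.prems(1-3)
  have meas: "(\<lambda>y. \<integral>\<^sup>+x. k (x(i := y)) \<partial>Pi\<^sub>M I (\<lambda>_. lborel)) \<in> borel_measurable borel"
    if [measurable]: "k \<in> borel_measurable (Pi\<^sub>M (insert i I) (\<lambda>_. lborel))" for k :: "('i \<Rightarrow> real) \<Rightarrow> ennreal"
    by (intro I.borel_measurable_nn_integral) measurable
  have "(\<integral>\<^sup>+y. \<integral>\<^sup>+x. f (x(i := y)) \<partial>Pi\<^sub>M I (\<lambda>_. lborel) \<partial>lborel)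
      * (\<integral>\<^sup>+y. \<integral>\<^sup>+x. g (x(i := y)) \<partial>Pi\<^sub>M I (\<lambda>_. lborel) \<partial>lborel)
      \<le> (\<integral>\<^sup>+y. \<integral>\<^sup>+x. h (x(i := y)) \<partial>Pi\<^sub>M I (\<lambda>_. lborel) \<partial>lborel)\<^sup>2"
  proof (intro Prekopa_Leindler_real meas insert.prems(1-3))
    fix s t :: real
    have mid: "(\<lambda>j\<in>insert i I. ((x(i := s)) j + (y(i := t)) j) / 2)
        = (\<lambda>j\<in>I. (x j + y j) / 2)(i := (s + t) / 2)" for x y :: "'i \<Rightarrow> real"
      using insert.hyps by (auto simp: fun_eq_iff restrict_def)
    show "(\<integral>\<^sup>+x. f (x(i := s)) \<partial>Pi\<^sub>M I (\<lambda>_. lborel)) * (\<integral>\<^sup>+x. g (x(i := t)) \<partial>Pi\<^sub>M I (\<lambda>_. lborel))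
        \<le> (\<integral>\<^sup>+x. h (x(i := (s + t) / 2)) \<partial>Pi\<^sub>M I (\<lambda>_. lborel))\<^sup>2"
    proof (rule insert.IH)
      fix x y :: "'i \<Rightarrow> real" assume "x \<in> extensional I" "y \<in> extensional I"
      then show "f (x(i := s)) * g (y(i := t)) \<le> (h ((\<lambda>j\<in>I. (x j + y j) / 2)(i := (s + t) / 2)))\<^sup>2"
        unfolding mid[symmetric] by (intro insert.prems(4)) (auto simp: extensional_def)
    qed measurable
  qed
  then show ?case
    using insert.hyps by (simp add: product_nn_integral_insert_rev)
qed

text \<open>Prekopa-Leindler for indicator functions, carried over by the coordinate map
  \<open>T\<close>, which is linear and so respects midpoints.\<close>

theorem Brunn_Minkowski_midpoint:
  fixes A B C :: "'a::euclidean_space set"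
  assumes [measurable]: "A \<in> sets borel" "B \<in> sets borel" "C \<in> sets borel"
    and mid: "\<And>x y. x \<in> A \<Longrightarrow> y \<in> B \<Longrightarrow> midpoint x y \<in> C"
  shows "emeasure lborel A * emeasure lborel B \<le> (emeasure lborel C)\<^sup>2"
proof -
  define T where "T = (\<lambda>f::'a \<Rightarrow> real. \<Sum>b\<in>Basis. f b *\<^sub>R b)"
  have T [measurable]: "T \<in> Pi\<^sub>M Basis (\<lambda>_. lborel) \<rightarrow>\<^sub>M borel"
    unfolding T_def by measurable
  have eq: "emeasure lborel S = (\<integral>\<^sup>+x. indicator S (T x) \<partial>Pi\<^sub>M Basis (\<lambda>_. lborel))"
    if [measurable]: "S \<in> sets borel" for S
  proof -
    have "emeasure lborel S = (\<integral>\<^sup>+x. indicator S x \<partial>distr (Pi\<^sub>M Basis (\<lambda>_. lborel)) borel T)"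
      unfolding T_def lborel_eq[symmetric] by simp
    also have "\<dots> = (\<integral>\<^sup>+x. indicator S (T x) \<partial>Pi\<^sub>M Basis (\<lambda>_. lborel))"
      by (rule nn_integral_distr) auto
    finally show ?thesis .
  qed
  have T_mid: "T (\<lambda>i\<in>Basis. (x i + y i) / 2) = midpoint (T x) (T y)" for x y
  proof -
    have "T (\<lambda>i\<in>Basis. (x i + y i) / 2)
        = (\<Sum>b\<in>Basis. inverse 2 *\<^sub>R (x b *\<^sub>R b) + inverse 2 *\<^sub>R (y b *\<^sub>R b))"
      unfolding T_def
      by (intro sum.cong) (simp_all add: add_divide_distrib scaleR_left_distrib)
    then show ?thesis
      by (simp only: T_def midpoint_def scaleR_add_right scaleR_sum_right sum.distrib)
  qed
  show ?thesis
    unfolding eq[OF assms(1)] eq[OF assms(2)] eq[OF assms(3)]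
  proof (rule Prekopa_Leindler_PiM)
    fix x y :: "'a \<Rightarrow> real"
    show "indicator A (T x) * indicator B (T y) \<le> (indicator C (T (\<lambda>i\<in>Basis. (x i + y i) / 2)) :: ennreal)\<^sup>2"
      unfolding T_mid using mid by (auto simp: indicator_def)
  qed auto
qed

text \<open>Passing to the closure gives a Borel set of the same diameter. The midpoint of
  \<open>x\<close> and \<open>- z\<close> is half of \<open>x - z\<close>, so Brunn-Minkowski for
  the closure and its reflection, which have equal measure, compares squares of volumes with that of
  the ball.\<close>

theorem isodiametric_inequality:
  fixes U :: "'a::euclidean_space set"
  assumes U: "bounded U"
  shows "emeasure lborel (closure U) \<le> ennreal (unit_ball_vol (real DIM('a)) * (diameter U / 2) ^ DIM('a))"
proof -
  let ?K = "closure U" and ?C = "cball (0::'a) (diameter U / 2)"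
  have K: "?K \<in> sets borel" by simp
  have C: "emeasure lborel ?C = ennreal (unit_ball_vol (real DIM('a)) * (diameter U / 2) ^ DIM('a))"
    using diameter_ge_0[OF U] by (intro emeasure_cball) simp
  have neg: "emeasure lborel (uminus ` ?K) = emeasure lborel ?K"
    using emeasure_lebesgue_affine[of "-1" 0 ?K] closed_negations[of ?K]
    by (simp add: borel_closed)
  have "emeasure lborel ?K * emeasure lborel (uminus ` ?K) \<le> (emeasure lborel ?C)\<^sup>2"
  proof (rule Brunn_Minkowski_midpoint)
    fix x y assume "x \<in> ?K" "y \<in> uminus ` ?K"
    then obtain z where z: "x \<in> ?K" "z \<in> ?K" "y = - z" by auto
    then have "dist x z \<le> diameter U"
      using diameter_bounded_bound[of ?K x z] U by (simp add: diameter_closure bounded_closure)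
    then show "midpoint x y \<in> ?C"
      by (simp add: z midpoint_def dist_norm)
  qed (use closed_negations[of ?K] in \<open>auto simp: borel_closed\<close>)
  then have "emeasure lborel ?K * emeasure lborel ?K \<le> emeasure lborel ?C * emeasure lborel ?C"
    by (simp add: neg power2_eq_square)
  \<comment> \<open>The square can be cancelled because the closure of a bounded set has finite
    measure.\<close>
  then have "emeasure lborel ?K \<le> emeasure lborel ?C"
  proof (rule contrapos_pp)
    assume "\<not> emeasure lborel ?K \<le> emeasure lborel ?C"
    then have lt: "emeasure lborel ?C < emeasure lborel ?K" by simp
    have "emeasure lborel ?C * emeasure lborel ?C \<le> emeasure lborel ?K * emeasure lborel ?C"
      using lt by (intro mult_right_mono) auto
    also have "\<dots> < emeasure lborel ?K * emeasure lborel ?K"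
      using lt emeasure_bounded_finite[of ?K] U
      by (intro ennreal_mult_strict_left_mono) (auto simp: bounded_closure intro: le_less_trans[OF zero_le])
    finally show "\<not> emeasure lborel ?K * emeasure lborel ?K \<le> emeasure lborel ?C * emeasure lborel ?C"
      by (simp add: not_le)
  qed
  then show ?thesis by (simp only: C)
qed

subsection \<open>Hausdorff measure of full dimension is Lebesgue measure\<close>

lemma hausdorff_pre_le_countable_cover:
  assumes C: "countable C" and cover: "A \<subseteq> (\<Union>i\<in>C. W i)" and "0 \<le> \<delta>"
    and W: "\<And>i. i \<in> C \<Longrightarrow> bounded (W i) \<and> diameter (W i) \<le> \<delta>"
  shows "hausdorff_pre k \<delta> A \<le> (\<integral>\<^sup>+i. hausdorff_gauge k (W i) \<partial>count_space C)"
proof -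
  define J where "J = to_nat_on C ` C"
  define V where "V = (\<lambda>n. if n \<in> J then W (from_nat_into C n) else {})"
  have bij: "bij_betw (to_nat_on C) C J"
    unfolding J_def using C by (intro inj_on_imp_bij_betw inj_on_to_nat_on)
  have V: "V (to_nat_on C i) = W i" if "i \<in> C" for i
    using that C by (simp add: V_def J_def)
  have "V \<in> hausdorff_covers \<delta> A"
  proof -
    have "A \<subseteq> (\<Union>n. V n)"
      using cover V by fastforce
    moreover have "bounded (V n) \<and> diameter (V n) \<le> \<delta>" for n
      using W V \<open>0 \<le> \<delta>\<close> by (cases "n \<in> J") (auto simp: J_def, auto simp: V_def J_def)
    ultimately show ?thesis by (simp add: hausdorff_covers_def)
  qed
  then have "hausdorff_pre k \<delta> A \<le> (\<Sum>n. hausdorff_gauge k (V n))"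
    unfolding hausdorff_pre_def by (rule INF_lower)
  also have "\<dots> = (\<integral>\<^sup>+n. hausdorff_gauge k (V n) \<partial>count_space UNIV)"
    by (rule nn_integral_count_space_nat[symmetric])
  also have "\<dots> = (\<integral>\<^sup>+n. hausdorff_gauge k (V n) \<partial>count_space J)"
    by (rule nn_integral_count_space_eq) (auto simp: V_def hausdorff_gauge_def)
  also have "\<dots> = (\<integral>\<^sup>+i. hausdorff_gauge k (V (to_nat_on C i)) \<partial>count_space C)"
    by (rule nn_integral_bij_count_space[OF bij, symmetric])
  also have "\<dots> = (\<integral>\<^sup>+i. hausdorff_gauge k (W i) \<partial>count_space C)"
    by (intro nn_integral_cong) (simp add: V)
  finally show ?thesis .
qed

lemma hausdorff_pre_Un_le:
  assumes "0 \<le> \<delta>"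
  shows "hausdorff_pre k \<delta> (A \<union> B) \<le> hausdorff_pre k \<delta> A + hausdorff_pre k \<delta> B"
proof -
  let ?C = "\<lambda>n::nat. if n = 0 then A else if n = 1 then B else {}"
  have empty: "hausdorff_pre k \<delta> {} = 0"
    using hausdorff_pre_le_countable_cover[of "{}" "{}" "\<lambda>_. {}" \<delta> k] assms
    by (simp add: nn_integral_empty)
  moreover have "(\<Union>n. ?C n) = A \<union> B"
    by (force split: if_splits)
  moreover have "(\<Sum>n. hausdorff_pre k \<delta> (?C n)) = (\<Sum>n\<in>{0,1}. hausdorff_pre k \<delta> (?C n))"
    by (rule suminf_finite) (auto simp: empty)
  ultimately show ?thesis
    using hausdorff_pre_countably_subadditive[of k \<delta> ?C] by simp
qed

text \<open>The isodiametric inequality bounds the volume of the closure of each covering set by its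
  gauge.\<close>

lemma emeasure_lborel_le_cover:
  fixes A :: "'a::euclidean_space set"
  assumes U: "U \<in> hausdorff_covers \<delta> A"
  shows "emeasure lborel A \<le> (\<Sum>i. hausdorff_gauge DIM('a) (U i))"
proof -
  have "A \<subseteq> (\<Union>i. U i)"
    using U by (simp add: hausdorff_covers_def)
  also have "\<dots> \<subseteq> (\<Union>i. closure (U i))"
    by (intro UN_mono closure_subset order_refl)
  finally have "emeasure lborel A \<le> emeasure lborel (\<Union>i. closure (U i))"
    by (intro emeasure_mono) auto
  also have "\<dots> \<le> (\<Sum>i. emeasure lborel (closure (U i)))"
    by (intro emeasure_subadditive_countably) auto
  also have "\<dots> \<le> (\<Sum>i. hausdorff_gauge DIM('a) (U i))"
    using U isodiametric_inequality
    by (intro suminf_le) (auto simp: hausdorff_covers_def hausdorff_gauge_def)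
  finally show ?thesis .
qed

text \<open>Disposes of the null set left over by the Vitali covering theorem. Inside an open set of
  measure at most \<open>e / 5 ^ DIM('a)\<close>, the covering lemma selects disjoint balls whose
  fivefold enlargements cover \<open>N\<close>; enlarging multiplies their total volume by
  \<open>5 ^ DIM('a)\<close>.\<close>

lemma hausdorff_pre_negligible:
  fixes N :: "'a::euclidean_space set"
  assumes N: "negligible N" and \<delta>: "0 < \<delta>"
  shows "hausdorff_pre DIM('a) \<delta> N = 0"
proof -
  have "hausdorff_pre DIM('a) \<delta> N \<le> 0 + ennreal e" if e: "e > 0" for e
  proof -
    have "N \<in> sets lebesgue" using N negligible_imp_sets by blast
    moreover have "e / 5 ^ DIM('a) > 0" using e by simp
    ultimately obtain T where T: "open T" "N \<subseteq> T" "emeasure lebesgue (T - N) < ennreal (e / 5 ^ DIM('a))"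
      by (rule sets_lebesgue_outer_open)
    have T_less: "emeasure lborel T \<le> ennreal (e / 5 ^ DIM('a))"
    proof -
      have "emeasure lborel T = emeasure lebesgue T" using T by simp
      also have "\<dots> = emeasure lebesgue (T - N)"
        using T N by (intro emeasure_Diff_null_set[symmetric]) (auto simp: negligible_iff_null_sets)
      finally show ?thesis using T by simp
    qed
    \<comment> \<open>The bound \<open>\<delta> / 10\<close> keeps the diameter
      \<open>10 * r\<close> of the enlarged ball within \<open>\<delta>\<close>.\<close>
    have "\<exists>r. 0 < r \<and> r \<le> \<delta> / 10 \<and> ball x r \<subseteq> T" if xN: "x \<in> N" for x
    proof -
      obtain s where "0 < s" "ball x s \<subseteq> T" using openE[OF T(1) subsetD[OF T(2) xN]] .
      moreover have "ball x (min s (\<delta> / 10)) \<subseteq> ball x s" by (rule subset_ball) simp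
      ultimately show ?thesis using \<delta> by (intro exI[of _ "min s (\<delta> / 10)"]) auto
    qed
    then obtain r where r: "\<And>x. x \<in> N \<Longrightarrow> 0 < r x \<and> r x \<le> \<delta> / 10 \<and> ball x (r x) \<subseteq> T"
      by metis
    have "N \<subseteq> (\<Union>x\<in>N. ball x (r x))"
      using r by auto
    moreover have "0 < r x \<and> r x \<le> \<delta> / 10" if "x \<in> N" for x
      using r[OF that] by simp
    ultimately obtain C where C: "countable C" "C \<subseteq> N"
        "pairwise (\<lambda>i j. disjnt (ball i (r i)) (ball j (r j))) C"
        "N \<subseteq> (\<Union>i\<in>C. ball i (5 * r i))"
      by (rule Vitali_covering_lemma_balls[where a="\<lambda>x. x"])
    have r0: "0 < r i" "10 * r i \<le> \<delta>" if "i \<in> C" for i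
      using r C(2) that by fastforce+
    have "hausdorff_pre DIM('a) \<delta> N \<le> (\<integral>\<^sup>+i. hausdorff_gauge DIM('a) (ball i (5 * r i)) \<partial>count_space C)"
      using C \<delta> r0 by (intro hausdorff_pre_le_countable_cover) (auto dest: less_imp_le)
    also have "\<dots> = (\<integral>\<^sup>+i. ennreal (5 ^ DIM('a)) * emeasure lborel (ball i (r i)) \<partial>count_space C)"
    proof (intro nn_integral_cong)
      fix i assume "i \<in> space (count_space C)"
      then have "0 < r i" using r0 by simp
      then show "hausdorff_gauge DIM('a) (ball i (5 * r i)) = ennreal (5 ^ DIM('a)) * emeasure lborel (ball i (r i))"
        by (simp add: hausdorff_gauge_def emeasure_ball power_mult_distrib ennreal_mult[symmetric] mult_ac
            not_less)
    qed
    also have "\<dots> = ennreal (5 ^ DIM('a)) * (\<integral>\<^sup>+i. emeasure lborel (ball i (r i)) \<partial>count_space C)"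
      by (rule nn_integral_cmult) simp
    also have "(\<integral>\<^sup>+i. emeasure lborel (ball i (r i)) \<partial>count_space C) = emeasure lborel (\<Union>i\<in>C. ball i (r i))"
      using C by (intro emeasure_UN_countable[symmetric])
        (auto simp: disjoint_family_on_def pairwise_def disjnt_def)
    also have "\<dots> \<le> emeasure lborel T"
      using r C(2) T by (intro emeasure_mono) (auto simp: subset_iff)
    also have "\<dots> \<le> ennreal (e / 5 ^ DIM('a))" by (rule T_less)
    also have "ennreal (5 ^ DIM('a)) * ennreal (e / 5 ^ DIM('a)) = ennreal e"
      using e by (simp add: ennreal_mult[symmetric] del: ennreal_power)
    finally show ?thesis by (simp add: mult_left_mono)
  qed
  then have "hausdorff_pre DIM('a) \<delta> N \<le> 0"
    by - (rule ennreal_le_epsilon, blast)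
  then show ?thesis by simp
qed

text \<open>For balls, gauge and volume coincide. Vitali's theorem fills \<open>A\<close> up to a
  null set by disjoint small balls inside an open set \<open>T\<close> barely larger than
  \<open>A\<close>, so their gauges sum to at most the measure of \<open>T\<close>.\<close>

lemma hausdorff_pre_le_lborel:
  fixes A :: "'a::euclidean_space set"
  assumes A: "A \<in> sets borel" and \<delta>: "0 < \<delta>"
  shows "hausdorff_pre DIM('a) \<delta> A \<le> emeasure lborel A"
proof (rule ennreal_le_epsilon)
  fix e :: real assume e: "0 < e"
  obtain T where T: "open T" "A \<subseteq> T" "emeasure lborel (T - A) < e"
    using outer_regular_lborel[OF A e] .
  define K where "K = {(x, r). 0 < r \<and> 2 * r \<le> \<delta> \<and> cball x r \<subseteq> T}"
  have fine: "\<exists>i. i \<in> K \<and> x \<in> cball (fst i) (snd i) \<and> snd i < d"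
    if x: "x \<in> A" and d: "0 < d" for x and d :: real
  proof -
    obtain s where s: "0 < s" "cball x s \<subseteq> T" using T x open_contains_cball by blast
    define r where "r = min (min s (\<delta> / 2)) (d / 2)"
    have "(x, r) \<in> K" "r < d" "0 \<le> r"
      using s d \<delta> by (auto simp: K_def r_def)
    then show ?thesis
      by (intro exI[of _ "(x, r)"]) auto
  qed
  have "\<And>i. i \<in> K \<Longrightarrow> 0 < snd i"
    by (auto simp: K_def)
  from Vitali_covering_theorem_cballs[of K snd A fst, OF this fine]
  obtain C where C: "countable C" "C \<subseteq> K"
      "pairwise (\<lambda>i j. disjnt (cball (fst i) (snd i)) (cball (fst j) (snd j))) C"
      "negligible (A - (\<Union>i\<in>C. cball (fst i) (snd i)))"
    by blast
  let ?W = "\<lambda>i. cball (fst i) (snd i) :: 'a set"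
  have K: "0 < snd i" "2 * snd i \<le> \<delta>" "?W i \<subseteq> T" if "i \<in> C" for i
    using subsetD[OF C(2) that] by (auto simp: K_def)
  have "hausdorff_pre DIM('a) \<delta> A \<le> hausdorff_pre DIM('a) \<delta> ((A - (\<Union>i\<in>C. ?W i)) \<union> (\<Union>i\<in>C. ?W i))"
    by (intro hausdorff_pre_mono) auto
  also have "\<dots> \<le> hausdorff_pre DIM('a) \<delta> (A - (\<Union>i\<in>C. ?W i)) + hausdorff_pre DIM('a) \<delta> (\<Union>i\<in>C. ?W i)"
    using \<delta> by (intro hausdorff_pre_Un_le) simp
  also have "\<dots> = hausdorff_pre DIM('a) \<delta> (\<Union>i\<in>C. ?W i)"
    using hausdorff_pre_negligible[OF C(4) \<delta>] by simp
  also have "\<dots> \<le> (\<integral>\<^sup>+i. hausdorff_gauge DIM('a) (?W i) \<partial>count_space C)"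
    using C(1) \<delta> K by (intro hausdorff_pre_le_countable_cover) (auto dest: less_imp_le)
  also have "\<dots> = (\<integral>\<^sup>+i. emeasure lborel (?W i) \<partial>count_space C)"
  proof (intro nn_integral_cong)
    fix i assume "i \<in> space (count_space C)"
    then have "0 < snd i" using K by simp
    then show "hausdorff_gauge DIM('a) (?W i) = emeasure lborel (?W i)"
      by (simp add: hausdorff_gauge_def emeasure_cball not_less)
  qed
  also have "\<dots> = emeasure lborel (\<Union>i\<in>C. ?W i)"
    using C by (intro emeasure_UN_countable[symmetric])
      (auto simp: disjoint_family_on_def pairwise_def disjnt_def)
  also have "\<dots> \<le> emeasure lborel (A \<union> (T - A))"
  proof (intro emeasure_mono)
    show "(\<Union>i\<in>C. ?W i) \<subseteq> A \<union> (T - A)" using K(3) by blast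
  qed (use A T in auto)
  also have "\<dots> \<le> emeasure lborel A + emeasure lborel (T - A)"
    using A T by (intro emeasure_subadditive) auto
  also have "\<dots> \<le> emeasure lborel A + ennreal e"
    using T(3) by (intro add_left_mono) simp
  finally show "hausdorff_pre DIM('a) \<delta> A \<le> emeasure lborel A + ennreal e" .
qed

text \<open>Both inequalities hold at every scale \<open>\<delta>\<close>, so the supremum over
  \<open>\<delta>\<close> is that of a constant.\<close>

theorem hausdorff_measure_DIM_eq_lborel:
  "hausdorff_measure DIM('a) = (lborel :: 'a::euclidean_space measure)"
proof (rule measure_eqI)
  fix A :: "'a set" assume "A \<in> sets (hausdorff_measure DIM('a))"
  then have A: "A \<in> sets borel" by simp
  have "hausdorff_pre DIM('a) \<delta> A = emeasure lborel A" if "\<delta> > 0" for \<delta>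
  proof (rule antisym)
    show "emeasure lborel A \<le> hausdorff_pre DIM('a) \<delta> A"
      unfolding hausdorff_pre_def by (rule INF_greatest) (rule emeasure_lborel_le_cover)
  qed (rule hausdorff_pre_le_lborel[OF A that])
  then have "hausdorff_outer DIM('a) A = (SUP \<delta>\<in>{0::real<..}. emeasure lborel A)"
    unfolding hausdorff_outer_def by (intro SUP_cong) auto
  also have "\<dots> = emeasure lborel A"
    by (rule SUP_const) simp
  finally have "hausdorff_outer DIM('a) A = emeasure lborel A" .
  then show "emeasure (hausdorff_measure DIM('a)) A = emeasure lborel A"
    using A by (simp add: emeasure_hausdorff_measure)
qed simp

text \<open>A set of diameter at most \<open>\<delta>\<close> has its gauge in the next dimension
  bounded by a multiple of \<open>\<delta>\<close> times its gauge. Covers of bounded total gauge in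
  codimension 1 therefore bound the volume by a multiple of \<open>\<delta>\<close>.\<close>

lemma null_sets_lborel_if_codim1_hausdorff_finite:
  fixes F :: "'a::euclidean_space set"
  assumes F: "F \<in> sets borel" and fin: "emeasure (hausdorff_measure (DIM('a) - 1)) F < \<infinity>"
  shows "F \<in> null_sets lborel"
proof -
  define n where "n = DIM('a) - 1"
  have d: "DIM('a) = Suc n" by (simp add: n_def)
  have "hausdorff_outer n F < top"
    using fin emeasure_hausdorff_measure[OF F] by (simp add: n_def)
  then obtain m where m: "hausdorff_outer n F = ennreal m" "0 \<le> m"
    by (cases "hausdorff_outer n F") auto
  \<comment> \<open>The ratio of the two normalising constants; the extra factor
    \<open>1 / 2\<close> belongs to the one power of \<open>diameter / 2\<close> that is split
    off.\<close>
  define c where "c = unit_ball_vol (real (Suc n)) / unit_ball_vol (real n) / 2"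
  have c: "c > 0" unfolding c_def by (intro divide_pos_pos unit_ball_vol_pos) auto
  have "emeasure lborel F \<le> 0 + ennreal e" if e: "e > 0" for e
  proof -
    \<comment> \<open>Chosen so that \<open>c * \<delta> * (m + 1) = e\<close>. The summand 1 gives
      room for a cover strictly below \<open>m + 1\<close> and avoids a zero denominator.\<close>
    define \<delta> where "\<delta> = e / (c * (m + 1))"
    have \<delta>: "\<delta> > 0" using e c m by (simp add: \<delta>_def)
    have "hausdorff_pre n \<delta> F < ennreal (m + 1)"
      using hausdorff_pre_le_outer[OF \<delta>, of n F] m by (auto simp: ennreal_less_iff elim: order.strict_trans1)
    then obtain U where U: "U \<in> hausdorff_covers \<delta> F" "(\<Sum>i. hausdorff_gauge n (U i)) < ennreal (m + 1)"
      unfolding hausdorff_pre_def INF_less_iff by blast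
    have gauge: "hausdorff_gauge (Suc n) (U i) \<le> ennreal (c * \<delta>) * hausdorff_gauge n (U i)" for i
    proof (cases "U i = {}")
      case False
      have dm: "0 \<le> diameter (U i)" "diameter (U i) \<le> \<delta>"
        using U diameter_ge_0 by (auto simp: hausdorff_covers_def)
      have b: "unit_ball_vol (real n) > 0" by simp
      have "unit_ball_vol (real (Suc n)) * (diameter (U i) / 2) ^ Suc n
          = c * diameter (U i) * (unit_ball_vol (real n) * (diameter (U i) / 2) ^ n)"
        using less_imp_neq[OF b] by (simp add: c_def)
      also have "\<dots> \<le> c * \<delta> * (unit_ball_vol (real n) * (diameter (U i) / 2) ^ n)"
        using dm c b by (intro mult_right_mono mult_left_mono) auto
      finally have "unit_ball_vol (real (Suc n)) * (diameter (U i) / 2) ^ Suc n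
          \<le> c * \<delta> * (unit_ball_vol (real n) * (diameter (U i) / 2) ^ n)" .
      then have "ennreal (unit_ball_vol (real (Suc n)) * (diameter (U i) / 2) ^ Suc n)
          \<le> ennreal (c * \<delta>) * ennreal (unit_ball_vol (real n) * (diameter (U i) / 2) ^ n)"
        using c \<delta> dm b by (subst ennreal_mult[symmetric]) (auto intro!: ennreal_leI mult_nonneg_nonneg)
      then show ?thesis using False by (simp only: hausdorff_gauge_def if_False)
    qed (simp add: hausdorff_gauge_def)
    have "emeasure lborel F \<le> (\<Sum>i. hausdorff_gauge (Suc n) (U i))"
      using emeasure_lborel_le_cover[OF U(1)] by (simp only: d)
    also have "\<dots> \<le> (\<Sum>i. ennreal (c * \<delta>) * hausdorff_gauge n (U i))"
      using gauge by (intro suminf_le) auto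
    also have "\<dots> = ennreal (c * \<delta>) * (\<Sum>i. hausdorff_gauge n (U i))"
      by simp
    also have "\<dots> \<le> ennreal (c * \<delta>) * ennreal (m + 1)"
      using U by (intro mult_left_mono) auto
    also have "\<dots> = ennreal e"
    proof -
      have "m + 1 \<noteq> 0" using m by linarith
      then have "c * \<delta> * (m + 1) = e"
        using c by (simp add: \<delta>_def)
      then show ?thesis
        using c m \<delta> by (subst ennreal_mult[symmetric]) auto
    qed
    finally show ?thesis by simp
  qed
  then have "emeasure lborel F \<le> 0" by - (rule ennreal_le_epsilon, blast)
  then show ?thesis using F by (auto simp: null_sets_def)
qed

subsection \<open>Blurred images\<close>

lemma lebesgue_affine_scaleR:
  fixes t :: "'a::euclidean_space"
  assumes "c \<noteq> 0"
  shows "lebesgue = density (distr lebesgue lebesgue (\<lambda>x. t + c *\<^sub>R x)) (\<lambda>_. \<bar>c\<bar> ^ DIM('a))"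
    and "(\<lambda>x. t + c *\<^sub>R x) \<in> lebesgue \<rightarrow>\<^sub>M lebesgue"
proof -
  have "(\<lambda>x. t + (\<Sum>j\<in>Basis. (c * (x \<bullet> j)) *\<^sub>R j)) = (\<lambda>x. t + c *\<^sub>R x)"
    unfolding scaleR_scaleR[symmetric] scaleR_sum_right[symmetric] euclidean_representation ..
  then show "lebesgue = density (distr lebesgue lebesgue (\<lambda>x. t + c *\<^sub>R x)) (\<lambda>_. \<bar>c\<bar> ^ DIM('a))"
    and "(\<lambda>x. t + c *\<^sub>R x) \<in> lebesgue \<rightarrow>\<^sub>M lebesgue"
    using lebesgue_affine_euclidean[of "\<lambda>_. c" t] lebesgue_affine_measurable[of "\<lambda>_. c" t] assms
    by (simp_all add: ennreal_power)
qed

lemma integral_lebesgue_affine: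
  fixes f :: "'a::euclidean_space \<Rightarrow> real"
  assumes f: "f \<in> borel_measurable lebesgue" and c: "c \<noteq> 0"
  shows "(LINT x|lebesgue. f x) = \<bar>c\<bar> ^ DIM('a) * (LINT x|lebesgue. f (t + c *\<^sub>R x))"
proof -
  note T = lebesgue_affine_scaleR[OF c, of t]
  have "(LINT x|lebesgue. f x)
      = integral\<^sup>L (density (distr lebesgue lebesgue (\<lambda>x. t + c *\<^sub>R x)) (\<lambda>_. ennreal (\<bar>c\<bar> ^ DIM('a)))) f"
    using T(1) by (simp add: ennreal_power)
  also have "\<dots> = (LINT x|distr lebesgue lebesgue (\<lambda>x. t + c *\<^sub>R x). \<bar>c\<bar> ^ DIM('a) *\<^sub>R f x)"
    using f by (intro integral_density) auto
  also have "\<dots> = \<bar>c\<bar> ^ DIM('a) * (LINT x|lebesgue. f (t + c *\<^sub>R x))"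
    using f by (subst integral_distr[OF T(2)]) auto
  finally show ?thesis .
qed

text \<open>The substitution \<open>z = x + a y\<close> moves the scale from the kernel to the set,
  leaving one fixed kernel that can dominate all integrands. A Borel version of
  \<open>\<rho>\<close>, equal to it almost everywhere, makes product measurability
  available.\<close>

lemma psf_blurred_representation:
  fixes \<rho> :: "'a::euclidean_space \<Rightarrow> real"
  assumes "psf \<rho>"
  obtains \<rho>' where "\<rho>' \<in> borel_measurable borel" "\<And>y. 0 \<le> \<rho>' y" "integrable lborel \<rho>'"
    "(LINT y|lborel. \<rho>' y) = 1"
    "\<And>a X x. 0 < a \<Longrightarrow> X \<in> sets borel \<Longrightarrow>
       blurred \<rho> a X x = (LINT y|lborel. indicator X (x + a *\<^sub>R y) * \<rho>' y)"
proof -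
  have \<rho>: "\<rho> \<in> borel_measurable lebesgue" "\<And>z. 0 \<le> \<rho> z" "(LINT z|lebesgue. \<rho> z) = 1"
    using assms by (auto simp: psf_def)
  obtain \<rho>0 where \<rho>0: "\<rho>0 \<in> borel_measurable lborel" "AE x in lborel. \<rho> x = \<rho>0 x"
    using completion_ex_borel_measurable_real[OF \<rho>(1)] by blast
  \<comment> \<open>The Borel version is nonnegative only almost everywhere; the maximum with 0
    makes it so everywhere.\<close>
  define \<rho>' where "\<rho>' = (\<lambda>y. max 0 (\<rho>0 y))"
  have meas [measurable]: "\<rho>' \<in> borel_measurable borel"
    using \<rho>0(1) by (simp add: \<rho>'_def)
  have ae: "AE x in lebesgue. \<rho> x = \<rho>' x"
    using AE_completion[OF \<rho>0(2)] by eventually_elim (metis \<rho>'_def \<rho>(2) max_absorb2)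
  have transfer: "(LINT y|lebesgue. k y * \<rho> y) = (LINT y|lborel. k y * \<rho>' y)"
    if [measurable]: "k \<in> borel_measurable borel" for k :: "'a \<Rightarrow> real"
  proof -
    have "(LINT y|lebesgue. k y * \<rho> y) = (LINT y|lebesgue. k y * \<rho>' y)"
      by (intro integral_cong_AE borel_measurable_times measurable_completion \<rho>(1)) (use ae in auto)
    also have "\<dots> = (LINT y|lborel. k y * \<rho>' y)"
      by (intro integral_completion) auto
    finally show ?thesis .
  qed
  have one: "(LINT y|lborel. \<rho>' y) = 1"
    using transfer[of "\<lambda>_. 1"] \<rho>(3) by simp
  \<comment> \<open>A non-integrable function has Bochner integral 0 by convention, so the integral
    1 forces integrability.\<close>
  then have int: "integrable lborel \<rho>'"
    using not_integrable_integral_eq by fastforce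
  have blur: "blurred \<rho> a X x = (LINT y|lborel. indicator X (x + a *\<^sub>R y) * \<rho>' y)"
    if a: "0 < a" and X [measurable]: "X \<in> sets borel" for a X x
  proof -
    let ?f = "\<lambda>z. indicator X z *\<^sub>R \<rho> ((1 / a) *\<^sub>R (z - x))"
    have "(\<lambda>z. \<rho> (- ((1 / a) *\<^sub>R x) + (1 / a) *\<^sub>R z)) \<in> borel_measurable lebesgue"
      by (rule measurable_compose[OF lebesgue_affine_scaleR(2) \<rho>(1)]) (use a in auto)
    then have "(\<lambda>z. \<rho> ((1 / a) *\<^sub>R (z - x))) \<in> borel_measurable lebesgue"
      by (simp add: scaleR_diff_right)
    moreover have "indicator X \<in> borel_measurable lebesgue"
      by (intro measurable_completion) simp
    ultimately have f: "?f \<in> borel_measurable lebesgue"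
      by (intro borel_measurable_scaleR) auto
    have "blurred \<rho> a X x = (1 / a ^ DIM('a)) * (LINT z|lebesgue. ?f z)"
      by (simp add: blurred_def set_lebesgue_integral_def)
    also have "\<dots> = (LINT y|lebesgue. ?f (x + a *\<^sub>R y))"
      using a by (subst integral_lebesgue_affine[OF f, of a x]) auto
    also have "\<dots> = (LINT y|lebesgue. indicator X (x + a *\<^sub>R y) * \<rho> y)"
      using a by simp
    also have "\<dots> = (LINT y|lborel. indicator X (x + a *\<^sub>R y) * \<rho>' y)"
      by (rule transfer) measurable
    finally show ?thesis .
  qed
  show ?thesis
    by (rule that[OF meas _ int one blur]) (auto simp: \<rho>'_def)
qed

lemma borel_measurable_blurred:
  fixes \<rho> :: "'a::euclidean_space \<Rightarrow> real"
  assumes \<rho>: "psf \<rho>" and a: "0 < a" and X [measurable]: "X \<in> sets borel"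
  shows "blurred \<rho> a X \<in> borel_measurable borel"
proof -
  obtain \<rho>' where [measurable]: "\<rho>' \<in> borel_measurable borel" and
    eq: "\<And>x. blurred \<rho> a X x = (LINT y|lborel. indicator X (x + a *\<^sub>R y) * \<rho>' y)"
    using psf_blurred_representation[OF \<rho>] a X by metis
  have "(\<lambda>x. LINT y|lborel. indicator X (x + a *\<^sub>R y) * \<rho>' y) \<in> borel_measurable borel"
    by (rule lborel.borel_measurable_lebesgue_integral) measurable
  then show ?thesis by (simp add: eq[abs_def])
qed

text \<open>For fixed \<open>y\<close>, the points \<open>x + s n y\<close> eventually stay on the
  same side of the frontier as \<open>x\<close>. Dominated convergence with majorant
  \<open>\<rho>'\<close>, of total mass 1, yields the limit.\<close>

lemma blurred_tendsto_indicator: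
  fixes \<rho> :: "'a::euclidean_space \<Rightarrow> real"
  assumes \<rho>: "psf \<rho>" and X: "closed X" and x: "x \<notin> frontier X"
    and s: "\<And>n. 0 < s n" "s \<longlonglongrightarrow> 0"
  shows "(\<lambda>n. blurred \<rho> (s n) X x) \<longlonglongrightarrow> indicator X x"
proof -
  have [measurable]: "X \<in> sets borel" using X by simp
  obtain \<rho>' where [measurable]: "\<rho>' \<in> borel_measurable borel" and \<rho>': "\<And>y. 0 \<le> \<rho>' y"
    "integrable lborel \<rho>'" "(LINT y|lborel. \<rho>' y) = 1" and
    eq: "\<And>a x. 0 < a \<Longrightarrow> blurred \<rho> a X x = (LINT y|lborel. indicator X (x + a *\<^sub>R y) * \<rho>' y)"
    using psf_blurred_representation[OF \<rho>] \<open>X \<in> sets borel\<close> by metis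
  have "(\<lambda>n. LINT y|lborel. indicator X (x + s n *\<^sub>R y) * \<rho>' y) \<longlonglongrightarrow> (LINT y|lborel. indicator X x * \<rho>' y)"
  proof (rule integral_dominated_convergence[where w=\<rho>'])
    show "AE y in lborel. (\<lambda>n. indicator X (x + s n *\<^sub>R y) * \<rho>' y) \<longlonglongrightarrow> indicator X x * \<rho>' y"
    proof (rule AE_I2)
      fix y
      have "(\<lambda>n. x + s n *\<^sub>R y) \<longlonglongrightarrow> x + 0 *\<^sub>R y"
        by (intro tendsto_intros s)
      then have lim: "(\<lambda>n. x + s n *\<^sub>R y) \<longlonglongrightarrow> x" by simp
      have "x \<in> interior X \<or> x \<in> - X"
        using x by (auto simp: frontier_def closure_closed[OF X])
      then have "\<forall>\<^sub>F n in sequentially. (x + s n *\<^sub>R y \<in> X) = (x \<in> X)"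
      proof
        assume "x \<in> interior X"
        then have "\<forall>\<^sub>F n in sequentially. x + s n *\<^sub>R y \<in> interior X"
          by (rule topological_tendstoD[OF lim open_interior])
        then show ?thesis
          by eventually_elim (use \<open>x \<in> interior X\<close> interior_subset in auto)
      next
        assume "x \<in> - X"
        then have "\<forall>\<^sub>F n in sequentially. x + s n *\<^sub>R y \<in> - X"
          by (rule topological_tendstoD[OF lim open_Compl[OF X]])
        then show ?thesis
          by eventually_elim (use \<open>x \<in> - X\<close> in auto)
      qed
      then have "\<forall>\<^sub>F n in sequentially. indicator X (x + s n *\<^sub>R y) * \<rho>' y = indicator X x * \<rho>' y"
        by eventually_elim (simp add: indicator_def)
      then show "(\<lambda>n. indicator X (x + s n *\<^sub>R y) * \<rho>' y) \<longlonglongrightarrow> indicator X x * \<rho>' y"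
        by (rule tendsto_eventually)
    qed
    show "AE y in lborel. norm (indicator X (x + s n *\<^sub>R y) * \<rho>' y) \<le> \<rho>' y" for n
      using \<rho>'(1) by (auto simp: indicator_def)
  qed (use \<rho>' in auto)
  then show ?thesis using \<rho>'(3) by (simp add: eq s)
qed

text \<open>Let \<open>X\<close> lie within radius \<open>R\<close>. If
  \<open>norm x > R + n\<close> and \<open>a \<le> 1\<close>, then \<open>x + a y\<close> can reach
  \<open>X\<close> only for \<open>norm y > n\<close>, so the blurred value is at most the mass of
  the kernel outside radius \<open>n\<close>. That tail falls below \<open>\<beta>\<close> for some
  \<open>n\<close>, independently of \<open>a\<close>.\<close>

lemma blurred_superlevel_bounded:
  fixes \<rho> :: "'a::euclidean_space \<Rightarrow> real"
  assumes \<rho>: "psf \<rho>" and X: "compact X" and \<beta>: "0 < \<beta>"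
  obtains B where "\<And>a x. 0 < a \<Longrightarrow> a \<le> 1 \<Longrightarrow> \<beta> \<le> blurred \<rho> a X x \<Longrightarrow> norm x \<le> B"
proof -
  have [measurable]: "X \<in> sets borel" using X by (simp add: borel_compact)
  obtain \<rho>' where [measurable]: "\<rho>' \<in> borel_measurable borel" and \<rho>': "\<And>y. 0 \<le> \<rho>' y"
    "integrable lborel \<rho>'" "(LINT y|lborel. \<rho>' y) = 1" and
    eq: "\<And>a x. 0 < a \<Longrightarrow> blurred \<rho> a X x = (LINT y|lborel. indicator X (x + a *\<^sub>R y) * \<rho>' y)"
    using psf_blurred_representation[OF \<rho>] \<open>X \<in> sets borel\<close> by metis
  obtain R where R: "\<And>z. z \<in> X \<Longrightarrow> norm z \<le> R"
    using compact_imp_bounded[OF X] by (auto simp: bounded_iff)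
  have "(\<lambda>n. LINT y|lborel. indicator {y. real n < norm y} y * \<rho>' y) \<longlonglongrightarrow> (LINT y|(lborel :: 'a measure). (0::real))"
  proof (rule integral_dominated_convergence[where w=\<rho>'])
    show "AE y in lborel. (\<lambda>n. indicator {y. real n < norm y} y * \<rho>' y) \<longlonglongrightarrow> 0"
    proof (rule AE_I2, rule tendsto_eventually)
      fix y :: 'a
      obtain N where "norm y \<le> real N" using real_arch_simple by blast
      then show "\<forall>\<^sub>F n in sequentially. indicator {y. real n < norm y} y * \<rho>' y = 0"
        by (intro eventually_sequentiallyI[of N]) (auto simp: indicator_def)
    qed
    show "AE y in lborel. norm (indicator {y. real n < norm y} y * \<rho>' y) \<le> \<rho>' y" for n
      using \<rho>'(1) by (auto simp: indicator_def)
  qed (use \<rho>' in auto)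
  then have "(\<lambda>n. LINT y|lborel. indicator {y. real n < norm y} y * \<rho>' y) \<longlonglongrightarrow> 0" by simp
  then have "\<forall>\<^sub>F n in sequentially. (LINT y|lborel. indicator {y. real n < norm y} y * \<rho>' y) < \<beta>"
    using \<beta> by (rule order_tendstoD(2))
  then obtain n where n: "(LINT y|lborel. indicator {y. real n < norm y} y * \<rho>' y) < \<beta>"
    by (auto simp: eventually_sequentially)
  have "norm x \<le> R + real n" if a: "0 < a" "a \<le> 1" "\<beta> \<le> blurred \<rho> a X x" for a x
  proof (rule ccontr)
    assume "\<not> norm x \<le> R + real n"
    have far: "real n < norm y" if "x + a *\<^sub>R y \<in> X" for y
    proof -
      have "norm x \<le> norm (x + a *\<^sub>R y) + norm (a *\<^sub>R y)"
        by (metis add_diff_cancel norm_triangle_ineq4)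
      also have "norm (a *\<^sub>R y) \<le> 1 * norm y"
        using a by (simp add: mult_left_le_one_le)
      finally show ?thesis
        using R[OF that] \<open>\<not> norm x \<le> R + real n\<close> by linarith
    qed
    have bdd: "integrable lborel (\<lambda>y. indicator S y * \<rho>' y)" if [measurable]: "S \<in> sets borel" for S
      using integrable_mult_indicator[OF _ \<rho>'(2), of S] by simp
    have "blurred \<rho> a X x = (LINT y|lborel. indicator {y. x + a *\<^sub>R y \<in> X} y * \<rho>' y)"
      using a by (simp add: eq indicator_def)
    also have "\<dots> \<le> (LINT y|lborel. indicator {y. real n < norm y} y * \<rho>' y)"
      using far \<rho>'(1) by (intro integral_mono bdd) (auto simp: indicator_def)
    finally show False using n a by linarith
  qed
  then show ?thesis using that by blast
qed

subsection \<open>Random lattices\<close>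

text \<open>\<open>representation\<close> is indexed by basis vectors; injectivity of
  \<open>v\<close> on its index range allows indexing by \<open>i\<close> instead.\<close>

definition basis_coord :: "(nat \<Rightarrow> 'a::euclidean_space) \<Rightarrow> nat \<Rightarrow> 'a \<Rightarrow> real" where
  "basis_coord v i x = representation (v ` {1..DIM('a)}) x (v i)"

lemma
  fixes v :: "nat \<Rightarrow> 'a::euclidean_space"
  assumes v: "is_basis v"
  shows linear_basis_coord: "linear (basis_coord v i)"
    and basis_coord_expansion: "(\<Sum>i=1..DIM('a). basis_coord v i x *\<^sub>R v i) = x"
    and basis_coord_sum: "j \<in> {1..DIM('a)} \<Longrightarrow> basis_coord v j (\<Sum>i=1..DIM('a). l i *\<^sub>R v i) = l j"
proof -
  let ?B = "v ` {1..DIM('a)}"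
  have B: "inj_on v {1..DIM('a)}" "independent ?B" "span ?B = UNIV"
    using v by (auto simp: is_basis_def)
  show lin: "linear (basis_coord v i)" for i
    by (rule linearI) (simp_all add: basis_coord_def representation_add[OF B(2)] representation_scale[OF B(2)] B(3)
        del: One_nat_def)
  show "(\<Sum>i=1..DIM('a). basis_coord v i x *\<^sub>R v i) = x"
    using sum_representation_eq[of ?B x ?B] B by (simp add: sum.reindex basis_coord_def)
  assume j: "j \<in> {1..DIM('a)}"
  have "basis_coord v j (v i) = (if i = j then 1 else 0)" if "i \<in> {1..DIM('a)}" for i
    using B j that by (simp add: basis_coord_def representation_basis inj_on_eq_iff)
  then have "(\<Sum>i=1..DIM('a). l i * basis_coord v j (v i)) = (\<Sum>i=1..DIM('a). if i = j then l i else 0)"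
    by (intro sum.cong) auto
  also have "\<dots> = l j"
    using j by simp
  finally show "basis_coord v j (\<Sum>i=1..DIM('a). l i *\<^sub>R v i) = l j"
    using lin[of j] by (simp add: linear_sum linear_scale)
qed

lemma fundamental_cell_iff:
  fixes v :: "nat \<Rightarrow> 'a::euclidean_space"
  assumes v: "is_basis v"
  shows "x \<in> fundamental_cell v \<longleftrightarrow> (\<forall>i\<in>{1..DIM('a)}. 0 \<le> basis_coord v i x \<and> basis_coord v i x < 1)"
proof
  assume "x \<in> fundamental_cell v"
  then show "\<forall>i\<in>{1..DIM('a)}. 0 \<le> basis_coord v i x \<and> basis_coord v i x < 1"
    using basis_coord_sum[OF v] by (auto simp: fundamental_cell_def)
next
  assume "\<forall>i\<in>{1..DIM('a)}. 0 \<le> basis_coord v i x \<and> basis_coord v i x < 1"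
  then show "x \<in> fundamental_cell v"
    unfolding fundamental_cell_def using basis_coord_expansion[OF v, of x, symmetric]
    by (intro CollectI exI[of _ "\<lambda>i. basis_coord v i x"]) auto
qed

lemma borel_fundamental_cell:
  fixes v :: "nat \<Rightarrow> 'a::euclidean_space"
  assumes v: "is_basis v"
  shows "fundamental_cell v \<in> sets borel"
proof -
  have [measurable]: "basis_coord v i \<in> borel_measurable borel" for i
    by (intro borel_measurable_continuous_onI linear_continuous_on linear_conv_bounded_linear[THEN iffD1]
        linear_basis_coord v)
  have "fundamental_cell v = {x\<in>space borel. \<forall>i\<in>{1..DIM('a)}. 0 \<le> basis_coord v i x \<and> basis_coord v i x < 1}"
    using fundamental_cell_iff[OF v] by auto
  also have "\<dots> \<in> sets borel" by measurable
  finally show ?thesis .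
qed

lemma bounded_fundamental_cell:
  fixes v :: "nat \<Rightarrow> 'a::euclidean_space"
  shows "bounded (fundamental_cell v)"
proof (rule boundedI)
  fix x assume "x \<in> fundamental_cell v"
  then obtain l where l: "x = (\<Sum>i=1..DIM('a). l i *\<^sub>R v i)" "\<And>i. i \<in> {1..DIM('a)} \<Longrightarrow> 0 \<le> l i \<and> l i < 1"
    by (auto simp: fundamental_cell_def)
  have "norm x \<le> (\<Sum>i=1..DIM('a). norm (l i *\<^sub>R v i))"
    unfolding l(1) by (rule norm_sum)
  also have "\<dots> \<le> (\<Sum>i=1..DIM('a). norm (v i))"
    using l(2) by (intro sum_mono) (auto intro!: mult_left_le_one_le simp: less_imp_le)
  finally show "norm x \<le> (\<Sum>i=1..DIM('a). norm (v i))" .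
qed

text \<open>Coordinates are linear, hence bounded on \<open>S\<close>, and lattice points have
  integer coordinates.\<close>

lemma finite_lattice_of_Int_bounded:
  fixes v :: "nat \<Rightarrow> 'a::euclidean_space"
  assumes v: "is_basis v" and S: "bounded S"
  shows "finite (lattice_of v \<inter> S)"
proof -
  have "bounded (basis_coord v i ` S)" for i
    using S by (rule bounded_linear_image[OF _ linear_conv_bounded_linear[THEN iffD1, OF linear_basis_coord[OF v]]])
  then have "\<exists>N. \<forall>x\<in>S. \<bar>basis_coord v i x\<bar> \<le> N" for i
    by (simp add: bounded_iff)
  then obtain N where N: "\<And>i x. x \<in> S \<Longrightarrow> \<bar>basis_coord v i x\<bar> \<le> N i"
    by metis
  \<comment> \<open>\<open>PiE\<close> fixes the coefficients outside the index range; with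
    arbitrary values there the set of coefficient functions would be infinite.\<close>
  let ?M = "PiE {1..DIM('a)} (\<lambda>i. {-\<lceil>N i\<rceil>..\<lceil>N i\<rceil>})"
  have "lattice_of v \<inter> S \<subseteq> (\<lambda>m. \<Sum>i=1..DIM('a). of_int (m i) *\<^sub>R v i) ` ?M"
  proof
    fix z assume z: "z \<in> lattice_of v \<inter> S"
    then obtain m where m: "z = (\<Sum>i=1..DIM('a). of_int (m i) *\<^sub>R v i)"
      by (auto simp: lattice_of_def)
    have "m i \<in> {-\<lceil>N i\<rceil>..\<lceil>N i\<rceil>}" if "i \<in> {1..DIM('a)}" for i
    proof -
      have "basis_coord v i z = of_int (m i)"
        unfolding m by (rule basis_coord_sum[OF v that])
      then have "\<bar>of_int (m i)\<bar> \<le> N i" using N[of z i] z by simp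
      then show ?thesis by (simp, linarith)
    qed
    then have M: "restrict m {1..DIM('a)} \<in> ?M" by auto
    show "z \<in> (\<lambda>m. \<Sum>i=1..DIM('a). of_int (m i) *\<^sub>R v i) ` ?M"
    proof (rule image_eqI[OF _ M])
      show "z = (\<Sum>i=1..DIM('a). of_int (restrict m {1..DIM('a)} i) *\<^sub>R v i)"
        unfolding m by (intro sum.cong) auto
    qed
  qed
  moreover have "finite ?M" by (intro finite_PiE) auto
  ultimately show ?thesis by (meson finite_imageI finite_subset)
qed

text \<open>The lattice point is obtained by rounding every coordinate of \<open>x\<close> down, and
  the half-open cell forces this choice.\<close>

lemma lattice_tiling:
  fixes v :: "nat \<Rightarrow> 'a::euclidean_space"
  assumes v: "is_basis v"
  shows "\<exists>!z. z \<in> lattice_of v \<and> x - z \<in> fundamental_cell v"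
proof (rule ex1I)
  let ?c = "\<lambda>i. basis_coord v i x"
  define z0 where "z0 = (\<Sum>i=1..DIM('a). of_int \<lfloor>?c i\<rfloor> *\<^sub>R v i)"
  have diff: "basis_coord v i (x - z) = ?c i - basis_coord v i z" for i z
    using linear_basis_coord[OF v] by (rule linear_diff)
  have "x - z0 \<in> fundamental_cell v"
    unfolding fundamental_cell_iff[OF v] diff
  proof (intro ballI)
    fix i assume "i \<in> {1..DIM('a)}"
    then have "basis_coord v i z0 = of_int \<lfloor>?c i\<rfloor>"
      unfolding z0_def by (rule basis_coord_sum[OF v])
    then show "0 \<le> ?c i - basis_coord v i z0 \<and> ?c i - basis_coord v i z0 < 1"
      by (simp, linarith)
  qed
  moreover have "z0 \<in> lattice_of v"
    unfolding lattice_of_def z0_def by (intro CollectI exI[of _ "\<lambda>i. \<lfloor>?c i\<rfloor>"]) simp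
  ultimately show "z0 \<in> lattice_of v \<and> x - z0 \<in> fundamental_cell v" by simp
  fix z assume z: "z \<in> lattice_of v \<and> x - z \<in> fundamental_cell v"
  then obtain m where m: "z = (\<Sum>i=1..DIM('a). of_int (m i) *\<^sub>R v i)"
    by (auto simp: lattice_of_def)
  have "m i = \<lfloor>?c i\<rfloor>" if "i \<in> {1..DIM('a)}" for i
  proof -
    have "basis_coord v i z = of_int (m i)"
      unfolding m by (rule basis_coord_sum[OF v that])
    moreover have "0 \<le> ?c i - basis_coord v i z" "?c i - basis_coord v i z < 1"
      using z that unfolding fundamental_cell_iff[OF v] diff by auto
    ultimately show ?thesis by linarith
  qed
  then show "z = z0"
    unfolding m z0_def by (intro sum.cong) auto
qed

lemma integral_lborel_affine:
  fixes f :: "'a::euclidean_space \<Rightarrow> real"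
  assumes [measurable]: "f \<in> borel_measurable borel" and c: "c \<noteq> 0"
  shows "(LINT x|lborel. f x) = \<bar>c\<bar> ^ DIM('a) * (LINT x|lborel. f (t + c *\<^sub>R x))"
  using integral_lebesgue_affine[of f c t] c by (simp add: integral_completion measurable_completion)

text \<open>
  Unfolding: averaging a lattice sum over a uniformly random shift of the lattice turns it into
  an integral, because the translates of the fundamental cell tile the space.
\<close>

lemma expectation_lattice_sum:
  fixes v :: "nat \<Rightarrow> 'a::euclidean_space" and g :: "'a \<Rightarrow> real"
  assumes v: "is_basis v" and vol: "emeasure lebesgue (fundamental_cell v) = 1"
    and a: "0 < a" and g [measurable]: "g \<in> borel_measurable borel"
    and supp: "\<And>x. g x \<noteq> 0 \<Longrightarrow> norm x \<le> B" and bdd: "\<And>x. \<bar>g x\<bar> \<le> G"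
  shows "(LINT c|uniform_measure lebesgue (fundamental_cell v).
            a ^ DIM('a) * (\<Sum>\<^sub>\<infinity>z\<in>scaled_shifted_lattice v a c. g z)) = (LINT x|lborel. g x)"
proof -
  let ?C = "fundamental_cell v" and ?L = "lattice_of v"
  have C [measurable]: "?C \<in> sets borel" by (rule borel_fundamental_cell[OF v])
  obtain D where D: "\<And>c. c \<in> ?C \<Longrightarrow> norm c \<le> D"
    using bounded_fundamental_cell[of v] by (auto simp: bounded_iff)
  \<comment> \<open>For shifts with \<open>norm c \<le> d\<close>, these are the only lattice points
    that can contribute: \<open>norm z \<le> norm (z + c) + norm c\<close>, and
    \<open>a (z + c)\<close> must lie within radius \<open>B\<close>.\<close>
  define F where "F = (\<lambda>d. ?L \<inter> cball 0 (B / a + d))"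
  have F: "finite (F d)" for d
    unfolding F_def by (intro finite_lattice_of_Int_bounded v) simp
  have in_F: "z \<in> F d" if z: "z \<in> ?L" and c: "norm c \<le> d" and gz: "g (a *\<^sub>R (z + c)) \<noteq> 0" for z c d
  proof -
    have "a * norm (z + c) \<le> B" using supp[OF gz] a by simp
    then have "norm (z + c) \<le> B / a" using a by (simp add: field_simps)
    moreover have "norm z \<le> norm (z + c) + norm c" by (metis add_diff_cancel norm_triangle_ineq4)
    ultimately show ?thesis using c z by (simp add: F_def)
  qed
  define S where "S = (\<lambda>c. \<Sum>\<^sub>\<infinity>z\<in>scaled_shifted_lattice v a c. g z)"
  have S: "S c = (\<Sum>z\<in>F d. g (a *\<^sub>R (z + c)))" if c: "norm c \<le> d" for c d
  proof -
    have "S c = (\<Sum>\<^sub>\<infinity>z\<in>?L. g (a *\<^sub>R (z + c)))"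
      unfolding S_def scaled_shifted_lattice_def using a
      by (subst infsum_reindex) (auto simp: inj_on_def o_def)
    also have "\<dots> = (\<Sum>\<^sub>\<infinity>z\<in>F d. g (a *\<^sub>R (z + c)))"
      using in_F[OF _ c] by (intro infsum_cong_neutral) (auto simp: F_def)
    also have "\<dots> = (\<Sum>z\<in>F d. g (a *\<^sub>R (z + c)))"
      using F by simp
    finally show ?thesis .
  qed
  \<comment> \<open>The sums over \<open>F (real n)\<close> are measurable in \<open>c\<close> and
    equal \<open>S c\<close> as soon as \<open>n\<close> exceeds \<open>norm c\<close>.\<close>
  have S_meas [measurable]: "S \<in> borel_measurable borel"
  proof (rule borel_measurable_LIMSEQ_real)
    fix c :: 'a assume "c \<in> space borel"
    obtain N where N: "norm c \<le> real N" using real_arch_simple by blast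
    then have "\<forall>\<^sub>F n in sequentially. (\<Sum>z\<in>F (real n). g (a *\<^sub>R (z + c))) = S c"
      by (intro eventually_sequentiallyI[of N]) (auto intro!: S[symmetric])
    then show "(\<lambda>n. \<Sum>z\<in>F (real n). g (a *\<^sub>R (z + c))) \<longlonglongrightarrow> S c"
      by (rule tendsto_eventually)
  qed measurable
  have int_C: "integrable lborel (\<lambda>c. indicator ?C c * g (a *\<^sub>R (z + c)))" for z
  proof (rule integrableI_bounded_set[where A="?C" and B=G])
    show "emeasure lborel ?C < \<infinity>" using vol C by simp
    show "AE c in lborel. c \<in> ?C \<longrightarrow> norm (indicator ?C c * g (a *\<^sub>R (z + c))) \<le> G"
      using bdd by (auto simp: indicator_def)
  qed auto
  have int_g: "integrable lborel (\<lambda>x. indicator ?C ((1 / a) *\<^sub>R x - z) * g x)" for z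
  proof (rule integrableI_bounded_set[where A="cball 0 B" and B=G])
    have "0 \<le> G" using bdd[of 0] by linarith
    then show "AE x in lborel. x \<in> cball 0 B \<longrightarrow> norm (indicator ?C ((1 / a) *\<^sub>R x - z) * g x) \<le> G"
      using bdd by (auto simp: indicator_def)
    show "AE x in lborel. x \<notin> cball 0 B \<longrightarrow> indicator ?C ((1 / a) *\<^sub>R x - z) * g x = 0"
      using supp by auto
    show "emeasure lborel (cball 0 B :: 'a set) < \<infinity>" by (rule emeasure_lborel_cball_finite)
  qed auto
  \<comment> \<open>Wherever \<open>g x\<close> is nonzero, exactly one lattice translate of the
    cell contains \<open>x / a\<close>; its lattice point lies in \<open>F D\<close> because the
    cell has radius at most \<open>D\<close>.\<close>
  have tile: "(\<Sum>z\<in>F D. indicator ?C ((1 / a) *\<^sub>R x - z) * g x) = g x" for x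
  proof (cases "g x = 0")
    case False
    obtain z0 where z0: "z0 \<in> ?L" "(1 / a) *\<^sub>R x - z0 \<in> ?C"
      and uniq: "\<And>z. z \<in> ?L \<Longrightarrow> (1 / a) *\<^sub>R x - z \<in> ?C \<Longrightarrow> z = z0"
      using lattice_tiling[OF v, of "(1 / a) *\<^sub>R x"] by blast
    have "a *\<^sub>R (z0 + ((1 / a) *\<^sub>R x - z0)) = x" using a by simp
    then have "g (a *\<^sub>R (z0 + ((1 / a) *\<^sub>R x - z0))) \<noteq> 0" using False by (simp only: not_False_eq_True)
    then have z0F: "z0 \<in> F D" by (rule in_F[OF z0(1) D[OF z0(2)]])
    have "(\<Sum>z\<in>F D. indicator ?C ((1 / a) *\<^sub>R x - z) * g x) = (\<Sum>z\<in>F D. if z = z0 then g x else 0)"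
    proof (intro sum.cong refl)
      fix z assume "z \<in> F D"
      then have "(1 / a) *\<^sub>R x - z \<in> ?C \<longleftrightarrow> z = z0"
        using uniq z0(2) by (auto simp: F_def)
      then show "indicator ?C ((1 / a) *\<^sub>R x - z) * g x = (if z = z0 then g x else 0)"
        by (auto simp: indicator_def)
    qed
    also have "\<dots> = g x" using z0F F by simp
    finally show ?thesis .
  qed simp
  have [measurable]: "(\<lambda>c. \<Sum>z\<in>F D. indicator ?C c * g (a *\<^sub>R (z + c))) \<in> borel_measurable borel"
    by measurable
  have "(LINT c|uniform_measure lebesgue ?C. a ^ DIM('a) * S c)
      = (LINT c|lebesgue. indicator ?C c * (a ^ DIM('a) * S c))"
  proof -
    \<comment> \<open>Unit volume of the cell makes the density a plain indicator.\<close>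
    have "uniform_measure lebesgue ?C = density lebesgue (\<lambda>c. ennreal (indicator ?C c))"
      unfolding uniform_measure_def vol by (simp add: ennreal_indicator divide_ennreal_def)
    then show ?thesis
      by (simp only:) (subst integral_density, auto intro!: measurable_completion)
  qed
  also have "\<dots> = (LINT c|lebesgue. a ^ DIM('a) * (\<Sum>z\<in>F D. indicator ?C c * g (a *\<^sub>R (z + c))))"
    by (intro Bochner_Integration.integral_cong) (auto simp: indicator_def S[OF D])
  also have "\<dots> = (LINT c|lborel. a ^ DIM('a) * (\<Sum>z\<in>F D. indicator ?C c * g (a *\<^sub>R (z + c))))"
    by (intro integral_completion) measurable
  also have "\<dots> = (\<Sum>z\<in>F D. a ^ DIM('a) * (LINT c|lborel. indicator ?C c * g (a *\<^sub>R (z + c))))"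
    by (simp add: int_C sum_distrib_left)
  also have "\<dots> = (\<Sum>z\<in>F D. LINT x|lborel. indicator ?C ((1 / a) *\<^sub>R x - z) * g x)"
  proof (rule sum.cong)
    fix z
    \<comment> \<open>Substitution \<open>c = x / a - z\<close>, whose Jacobian cancels the factor
      \<open>a ^ DIM('a)\<close>.\<close>
    have "(LINT c|lborel. indicator ?C c * g (a *\<^sub>R (z + c)))
        = \<bar>1 / a\<bar> ^ DIM('a) * (LINT x|lborel. indicator ?C (- z + (1 / a) *\<^sub>R x) * g (a *\<^sub>R (z + (- z + (1 / a) *\<^sub>R x))))"
      using a by (intro integral_lborel_affine) auto
    then show "a ^ DIM('a) * (LINT c|lborel. indicator ?C c * g (a *\<^sub>R (z + c)))
        = (LINT x|lborel. indicator ?C ((1 / a) *\<^sub>R x - z) * g x)"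
      using a by (simp add: power_one_over add.assoc[symmetric] field_simps)
  qed simp
  also have "\<dots> = (LINT x|lborel. (\<Sum>z\<in>F D. indicator ?C ((1 / a) *\<^sub>R x - z) * g x))"
    by (simp add: int_g)
  also have "\<dots> = (LINT x|lborel. g x)"
    by (simp only: tile)
  finally show ?thesis unfolding S_def .
qed

subsection \<open>Convergence of the expected estimator\<close>

text \<open>The function space carries the product topology, so convergence of tensors may be
  checked at each argument tuple \<open>w\<close>.\<close>

lemma tendsto_fun_componentwise:
  fixes f :: "'b \<Rightarrow> 'i \<Rightarrow> 'c::topological_space"
  assumes "\<And>i. ((\<lambda>a. f a i) \<longlongrightarrow> l i) F"
  shows "(f \<longlongrightarrow> l) F"
proof -
  have "limitin (product_topology (\<lambda>_. euclidean) UNIV) f l F"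
    using assms by (simp add: limitin_componentwise)
  then show ?thesis by (simp add: euclidean_product_topology)
qed

lemma abs_tensor_power_le:
  fixes x :: "'a::euclidean_space"
  assumes "norm x \<le> B"
  shows "\<bar>tensor_power x r w\<bar> \<le> (\<Prod>k=1..r. B * norm (w k))"
proof -
  have "\<bar>x \<bullet> w k\<bar> \<le> B * norm (w k)" for k
    using Cauchy_Schwarz_ineq2[of x "w k"] mult_right_mono[OF assms, of "norm (w k)"] by simp
  then show ?thesis
    unfolding tensor_power_def abs_prod by (intro prod_mono) auto
qed

lemma borel_measurable_tensor_power [measurable]:
  "(\<lambda>x::'a::euclidean_space. tensor_power x r w) \<in> borel_measurable borel"
  unfolding tensor_power_def by measurable

theorem mainTheorem4:
  fixes X :: "'a::euclidean_space set" and \<rho> :: "'a \<Rightarrow> real" and v :: "nat \<Rightarrow> 'a"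
    and \<beta> :: real and r :: nat
  assumes "is_basis v" and "emeasure lebesgue (fundamental_cell v) = 1"
    and "compact X" and "emeasure (hausdorff_measure (DIM('a) - 1)) (frontier X) < \<infinity>"
    and "psf \<rho>" and "0 < \<beta>" and "\<beta> < 1"
  shows "((\<lambda>a. expected_estimator \<rho> v \<beta> r a X) \<longlongrightarrow> volume_tensor r X) (at_right 0)"
proof (rule tendsto_fun_componentwise)
  fix w :: "nat \<Rightarrow> 'a"
  have X: "closed X" and X_borel [measurable]: "X \<in> sets borel"
    using \<open>compact X\<close> by (auto simp: compact_imp_closed borel_compact)
  obtain B where B: "\<And>a x. 0 < a \<Longrightarrow> a \<le> 1 \<Longrightarrow> \<beta> \<le> blurred \<rho> a X x \<Longrightarrow> norm x \<le> B"
    using blurred_superlevel_bounded[OF \<open>psf \<rho>\<close> \<open>compact X\<close> \<open>0 < \<beta>\<close>] by blast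
  \<comment> \<open>\<open>B\<close> could be negative if no superlevel set has a point; clipping at
    0 keeps the bound \<open>G\<close> nonnegative, as needed where \<open>g\<close>
    vanishes.\<close>
  define B' where "B' = max 0 B"
  define G where "G = (\<Prod>k=1..r. B' * norm (w k))"
  define g where "g = (\<lambda>a x. indicator {z. blurred \<rho> a X z \<ge> \<beta>} x * tensor_power x r w)"
  have g_meas [measurable]: "g a \<in> borel_measurable borel" if "0 < a" for a
  proof -
    have [measurable]: "blurred \<rho> a X \<in> borel_measurable borel"
      by (rule borel_measurable_blurred[OF \<open>psf \<rho>\<close> that X_borel])
    show ?thesis unfolding g_def by measurable
  qed
  have g_supp: "norm x \<le> B'" if "g a x \<noteq> 0" "0 < a" "a \<le> 1" for a x
    using that B[of a x] by (auto simp: g_def B'_def indicator_def split: if_splits)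
  have g_le: "\<bar>g a x\<bar> \<le> G" if a: "0 < a" "a \<le> 1" for a x
  proof (cases "g a x = 0")
    case False
    then have "\<bar>g a x\<bar> = \<bar>tensor_power x r w\<bar>" by (auto simp: g_def indicator_def)
    also have "\<dots> \<le> G" unfolding G_def by (intro abs_tensor_power_le g_supp[OF False a])
    finally show ?thesis .
  next
    case True
    have "0 \<le> G" unfolding G_def B'_def by (intro prod_nonneg) auto
    with True show ?thesis by simp
  qed
  have expected: "expected_estimator \<rho> v \<beta> r a X w = (1 / fact r) * (LINT x|lborel. g a x)"
    if a: "0 < a" "a \<le> 1" for a
  proof -
    have "expected_estimator \<rho> v \<beta> r a X w
        = (LINT c|uniform_measure lebesgue (fundamental_cell v). (1 / fact r) *
            (a ^ DIM('a) * (\<Sum>\<^sub>\<infinity>z\<in>scaled_shifted_lattice v a c. g a z)))"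
      by (simp add: expected_estimator_def volume_tensor_estimator_def g_def mult_ac)
    also have "\<dots> = (1 / fact r) * (LINT c|uniform_measure lebesgue (fundamental_cell v).
            a ^ DIM('a) * (\<Sum>\<^sub>\<infinity>z\<in>scaled_shifted_lattice v a c. g a z))"
      by (rule integral_mult_right_zero)
    also have "(LINT c|uniform_measure lebesgue (fundamental_cell v).
            a ^ DIM('a) * (\<Sum>\<^sub>\<infinity>z\<in>scaled_shifted_lattice v a c. g a z)) = (LINT x|lborel. g a x)"
      using assms(1,2) a g_supp g_le by (intro expectation_lattice_sum[where B=B' and G=G]) auto
    finally show ?thesis .
  qed
  have frontier: "AE x in lborel. x \<notin> frontier X"
    using null_sets_lborel_if_codim1_hausdorff_finite[of "frontier X"] assms(4)
    by (intro AE_not_in) auto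
  have lim: "((\<lambda>a. LINT x|lborel. g a x) \<longlongrightarrow> (LINT x|lborel. indicator X x * tensor_power x r w)) (at_right 0)"
    unfolding tendsto_at_iff_sequentially o_def
  proof (intro allI impI)
    fix s :: "nat \<Rightarrow> real" assume "\<forall>i. s i \<in> {0<..} - {0}" and s0: "s \<longlonglongrightarrow> 0"
    then have s: "\<And>n. 0 < s n" by auto
    have "\<forall>\<^sub>F n in sequentially. s n < 1"
      using s0 by (rule order_tendstoD(2)) simp
    \<comment> \<open>Dropping the first \<open>N\<close> terms brings all scales below 1, where the
      uniform support and size bounds hold.\<close>
    then obtain N where N: "\<And>n. N \<le> n \<Longrightarrow> s n \<le> 1"
      by (force simp: eventually_sequentially)
    have "(\<lambda>n. LINT x|lborel. g (s (n + N)) x) \<longlonglongrightarrow> (LINT x|lborel. indicator X x * tensor_power x r w)"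
    proof (rule integral_dominated_convergence[where w="\<lambda>x. indicator (cball 0 B') x * G"])
      show "integrable lborel (\<lambda>x. indicator (cball 0 B') x * G)"
        by (intro integrable_mult_left integrable_real_indicator emeasure_lborel_cball_finite) simp
      show "AE x in lborel. norm (g (s (n + N)) x) \<le> indicator (cball 0 B') x * G" for n
        using g_supp[of "s (n + N)"] g_le[of "s (n + N)"] s N by (auto simp: indicator_def)
      show "AE x in lborel. (\<lambda>n. g (s (n + N)) x) \<longlonglongrightarrow> indicator X x * tensor_power x r w"
        using frontier
      proof eventually_elim
        case (elim x)
        have "(\<lambda>n. blurred \<rho> (s (n + N)) X x) \<longlonglongrightarrow> indicator X x"
          using blurred_tendsto_indicator[OF \<open>psf \<rho>\<close> X elim, of "\<lambda>n. s (n + N)"] s s0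
          by (simp add: LIMSEQ_ignore_initial_segment)
        \<comment> \<open>The limit is 0 or 1 and \<open>\<beta>\<close> lies strictly between, so
          the threshold eventually decides membership in \<open>X\<close>.\<close>
        then have "\<forall>\<^sub>F n in sequentially. (\<beta> \<le> blurred \<rho> (s (n + N)) X x) = (x \<in> X)"
        proof (cases "x \<in> X")
          case True
          then have "\<forall>\<^sub>F n in sequentially. \<beta> < blurred \<rho> (s (n + N)) X x"
            using order_tendstoD(1)[OF \<open>_ \<longlonglongrightarrow> indicator X x\<close>, of \<beta>] \<open>\<beta> < 1\<close> by simp
          then show ?thesis by eventually_elim (simp add: True)
        next
          case False
          then have "\<forall>\<^sub>F n in sequentially. blurred \<rho> (s (n + N)) X x < \<beta>"
            using order_tendstoD(2)[OF \<open>_ \<longlonglongrightarrow> indicator X x\<close>, of \<beta>] \<open>0 < \<beta>\<close> by simp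
          then show ?thesis by eventually_elim (simp add: False)
        qed
        then have "\<forall>\<^sub>F n in sequentially. g (s (n + N)) x = indicator X x * tensor_power x r w"
          by eventually_elim (simp add: g_def indicator_def)
        then show ?case by (rule tendsto_eventually)
      qed
    qed (use s in measurable)
    then show "(\<lambda>n. LINT x|lborel. g (s n) x) \<longlonglongrightarrow> (LINT x|lborel. indicator X x * tensor_power x r w)"
      by (rule LIMSEQ_offset)
  qed
  have volume: "volume_tensor r X w = (1 / fact r) * (LINT x|lborel. indicator X x * tensor_power x r w)"
    by (simp add: volume_tensor_def set_lebesgue_integral_def hausdorff_measure_DIM_eq_lborel)
  have "\<forall>\<^sub>F a in at_right (0::real). a \<in> {0<..<1}"
    by (rule eventually_at_right_real) simp
  then have "\<forall>\<^sub>F a in at_right 0. (1 / fact r) * (LINT x|lborel. g a x) = expected_estimator \<rho> v \<beta> r a X w"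
    by eventually_elim (simp add: expected)
  moreover have "((\<lambda>a. (1 / fact r) * (LINT x|lborel. g a x)) \<longlongrightarrow> volume_tensor r X w) (at_right 0)"
    unfolding volume by (intro tendsto_mult tendsto_const lim)
  ultimately show "((\<lambda>a. expected_estimator \<rho> v \<beta> r a X w) \<longlongrightarrow> volume_tensor r X w) (at_right 0)"
    by (rule Lim_transform_eventually[rotated])
qed

end
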